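(* Let $$H^{m',n'}_{p',q'}\left[t\,\Big|\begin{array}{c}(\alpha'_j,A'_j)_1^{p'}\\(\beta'_j,B'_j)_1^{q'}\end{array}\right]\quad\text{and}\quad H^{m'',n''}_{p'',q''}\left[t\,\Big|\begin{array}{c}(\alpha''_j,A''_j)_1^{p''}\\(\beta''_j,B''_j)_1^{q''}\end{array}\right]$$ be two Fox $H$-functions with real $\alpha'_j,\beta'_j,\alpha''_j,\beta''_j$ and positive $A'_j,B'_j,A''_j,B''_j$, both defined and positive for every $t>0$. Assume $$\chi'=\sum_{j=1}^{n'}A'_j-\sum_{j=n'+1}^{p'}A'_j+\sum_{j=1}^{m'}B'_j-\sum_{j=m'+1}^{q'}B'_j>0,\quad \chi''=\sum_{j=1}^{n''}A''_j-\sum_{j=n''+1}^{p''}A''_j+\sum_{j=1}^{m''}B''_j-\sum_{j=m''+1}^{q''}B''_j>0,$$ $$-\min_{l=1,\dots,m'}\left\{\frac{\beta'_l}{B'_l}\right\}<\min_{l=1,\dots,n'}\left\{\frac{1-\alpha'_l}{A'_l}\right\},\qquad -\min_{l=1,\dots,m''}\left\{\frac{\beta''_l}{B''_l}\right\}<\min_{l=1,\dots,n''}\left\{\frac{1-\alpha''_l}{A''_l}\right\}.$$ Let $\lambda>0$ and let $\omega\in\mathbb{R}$ satisfy $$-\lambda\min_{l=1,\dots,m'}\left\{\frac{\beta'_l}{B'_l}\right\}-\min_{l=1,\dots,m''}\left\{\frac{\beta''_l}{B''_l}\right\}<\omega<\lambda\min_{l=1,\dots,n'}\left\{\frac{1-\alpha'_l}{A'_l}\right\}+\min_{l=1,\dots,n''}\left\{\frac{1-\alpha''_l}{A''_l}\right\}.$$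 Define $$(\alpha'''_j,A'''_j)_1^{p'+q''}=(\alpha'_j,A'_j)_1^{n'},\,(1-\beta''_j-\omega B''_j,\lambda B''_j)_1^{q''},\,(\alpha'_j,A'_j)_{n'+1}^{p'},$$ $$(\beta'''_j,B'''_j)_1^{q'+p''}=(\beta'_j,B'_j)_1^{m'},\,(1-\alpha''_j-\omega A''_j,\lambda A''_j)_1^{p''},\,(\beta'_j,B'_j)_{m'+1}^{q'}.$$ Then $$H^{m'+n'',n'+m''}_{p'+q'',q'+p''}\left[t\,\Big|\begin{array}{c}(\alpha'''_j,A'''_j)_1^{p'+q''}\\(\beta'''_j,B'''_j)_1^{q'+p''}\end{array}\right]>0\qquad\text{for every }t>0.$$
   Context: $\mathbb{N}_0=\{0,1,2,\dots\}$. The notation $(x_j,X_j)_i^l$ stands for the list $(x_i,X_i),\dots,(x_l,X_l)$ (the empty list if $l<i$); lists separated by commas are concatenated. A minimum over an empty index set is $+\infty$. Fox $H$-function. For $0\le n\le p$, $0\le m\le q$, $A_j,B_j>0$, $\alpha_j,\beta_j\in\mathbb{C}$ with $A_j(l+\beta_{j'})\ne B_{j'}(\alpha_j-l'-1)$ for all $1\le j\le n$, $1\le j'\le m$, $l,l'\in\mathbb{N}_0$, put $$\Xi^{m,n}_{p,q}(s)=\frac{\prod_{j=1}^m\Gamma(\beta_j+B_js)\prod_{j=1}^n\Gamma(1-\alpha_j-A_js)}{\prod_{j=m+1}^q\Gamma(1-\beta_j-B_js)\prod_{j=n+1}^p\Gamma(\alpha_j+A_js)}$$ (empty products are $1$),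 and $$H^{m,n}_{p,q}\left[z\,\Big|\begin{array}{c}(\alpha_j,A_j)_1^p\\(\beta_j,B_j)_1^q\end{array}\right]=\frac{1}{2\pi i}\int_{\mathcal C}\Xi^{m,n}_{p,q}(s)\,z^{-s}\,ds .$$ Let $\chi=\sum_{j=1}^nA_j-\sum_{j=n+1}^pA_j+\sum_{j=1}^mB_j-\sum_{j=m+1}^qB_j$. When $\chi>0$ (as is the case for all $H$-functions here) and $z>0$, $\mathcal C$ is a contour going from $\gamma-i\infty$ to $\gamma+i\infty$ ($\gamma\in\mathbb{R}$), leaving all poles of $\Gamma(\beta_j+B_js)$, $1\le j\le m$, on its left and all poles of $\Gamma(1-\alpha_j-A_js)$, $1\le j\le n$, on its right; the integral converges and does not depend on the choice of such a contour. *)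

theory Defs
  imports "HOL-Complex_Analysis.Complex_Analysis" "HOL-Library.Complex_Order"
begin

text \<open>
  A parameter list $(\alpha_j, A_j)_1^p$ is a list of pairs of length $p$; its first $n$ entries
  are \<open>take n\<close> of it and the entries $n+1,\dots,p$ are \<open>drop n\<close> of it.
\<close>

definition fox_H_params :: "nat \<Rightarrow> nat \<Rightarrow> (complex \<times> real) list \<Rightarrow> (complex \<times> real) list \<Rightarrow> bool" where
  "fox_H_params m n as bs \<longleftrightarrow>
     n \<le> length as \<and> m \<le> length bs \<and>
     (\<forall>(\<alpha>, A) \<in> set as. A > 0) \<and> (\<forall>(\<beta>, B) \<in> set bs. B > 0) \<and>
     (\<forall>(\<alpha>, A) \<in> set (take n as). \<forall>(\<beta>, B) \<in> set (take m bs). \<forall>l l' :: nat.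
        of_real A * (of_nat l + \<beta>) \<noteq> of_real B * (\<alpha> - of_nat l' - 1))"

text \<open>
  \<^const>\<open>Gamma\<close> is \<open>0\<close> at its poles and division by \<open>0\<close> gives \<open>0\<close>, so that, as it should,
  the integrand vanishes where a Gamma factor of the denominator has a pole (and no factor of
  the numerator does).
\<close>

definition fox_Xi ::
  "nat \<Rightarrow> nat \<Rightarrow> (complex \<times> real) list \<Rightarrow> (complex \<times> real) list \<Rightarrow> complex \<Rightarrow> complex" where
  "fox_Xi m n as bs s =
     ((\<Prod>(\<beta>, B) \<leftarrow> take m bs. Gamma (\<beta> + of_real B * s)) *
      (\<Prod>(\<alpha>, A) \<leftarrow> take n as. Gamma (1 - \<alpha> - of_real A * s))) /
     ((\<Prod>(\<beta>, B) \<leftarrow> drop m bs. Gamma (1 - \<beta> - of_real B * s)) *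
      (\<Prod>(\<alpha>, A) \<leftarrow> drop n as. Gamma (\<alpha> + of_real A * s)))"

text \<open>
  A contour from $\gamma - i\infty$ to $\gamma + i\infty$ is a simple piecewise continuously
  differentiable curve, parametrised by the whole real line, which agrees with the vertical line
  $\mathrm{Re}\,s = \gamma$ near both ends.
\<close>

definition vertical_contour :: "real \<Rightarrow> (real \<Rightarrow> complex) \<Rightarrow> bool" where
  "vertical_contour \<gamma> g \<longleftrightarrow>
     g piecewise_C1_differentiable_on UNIV \<and> inj g \<and>
     (\<forall>\<^sub>F y in at_bot. g y = Complex \<gamma> y) \<and> (\<forall>\<^sub>F y in at_top. g y = Complex \<gamma> y)"

text \<open>
  Such a curve divides the plane into two components and runs upwards at both ends. The component
  on its left is the one that contains all real numbers close enough to $-\infty$, the one on its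
  right contains all real numbers close enough to $+\infty$.
\<close>

definition left_of_contour :: "(real \<Rightarrow> complex) \<Rightarrow> complex set" where
  "left_of_contour g =
     {s. \<forall>\<^sub>F x in at_bot. connected_component (- range g) s (complex_of_real x)}"

definition right_of_contour :: "(real \<Rightarrow> complex) \<Rightarrow> complex set" where
  "right_of_contour g =
     {s. \<forall>\<^sub>F x in at_top. connected_component (- range g) s (complex_of_real x)}"

definition separates_poles ::
  "nat \<Rightarrow> nat \<Rightarrow> (complex \<times> real) list \<Rightarrow> (complex \<times> real) list \<Rightarrow> (real \<Rightarrow> complex) \<Rightarrow> bool" where
  "separates_poles m n as bs g \<longleftrightarrow>
     (\<forall>(\<beta>, B) \<in> set (take m bs).
        \<forall>s. is_pole (\<lambda>u. Gamma (\<beta> + of_real B * u)) s \<longrightarrow> s \<in> left_of_contour g) \<and>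
     (\<forall>(\<alpha>, A) \<in> set (take n as).
        \<forall>s. is_pole (\<lambda>u. Gamma (1 - \<alpha> - of_real A * u)) s \<longrightarrow> s \<in> right_of_contour g)"

definition has_vertical_contour_integral ::
  "(complex \<Rightarrow> complex) \<Rightarrow> complex \<Rightarrow> (real \<Rightarrow> complex) \<Rightarrow> bool" where
  "has_vertical_contour_integral f I g \<longleftrightarrow>
     ((\<lambda>y. f (g y) * vector_derivative g (at y)) has_integral I) UNIV"

text \<open>
  The common value of the integrals over all admissible contours. This is meant for
  \<open>z > 0\<close> and parameters with \<^const>\<open>fox_H_params\<close> and \<open>\<chi> > 0\<close> (\<open>fox_chi\<close> below).
\<close>

definition fox_H ::
  "nat \<Rightarrow> nat \<Rightarrow> (complex \<times> real) list \<Rightarrow> (complex \<times> real) list \<Rightarrow> real \<Rightarrow> complex" where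
  "fox_H m n as bs z =
     (THE w. \<exists>\<gamma> g I. vertical_contour \<gamma> g \<and> separates_poles m n as bs g \<and>
        has_vertical_contour_integral
          (\<lambda>s. fox_Xi m n as bs s * complex_of_real z powr (- s)) I g \<and>
        w = 1 / (2 * of_real pi * \<i>) * I)"

definition fox_chi :: "nat \<Rightarrow> nat \<Rightarrow> ('a \<times> real) list \<Rightarrow> ('a \<times> real) list \<Rightarrow> real" where
  "fox_chi m n as bs =
     (\<Sum>(\<alpha>, A) \<leftarrow> take n as. A) - (\<Sum>(\<alpha>, A) \<leftarrow> drop n as. A) +
     (\<Sum>(\<beta>, B) \<leftarrow> take m bs. B) - (\<Sum>(\<beta>, B) \<leftarrow> drop m bs. B)"

definition complex_params :: "(real \<times> real) list \<Rightarrow> (complex \<times> real) list" where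
  "complex_params = map (\<lambda>(\<alpha>, A). (complex_of_real \<alpha>, A))"

text \<open>
  The two minima, as extended reals: an infimum over a finite set is a minimum, and it is
  \<open>\<infinity>\<close> if the set is empty.
\<close>

definition beta_min :: "nat \<Rightarrow> (real \<times> real) list \<Rightarrow> ereal" where
  "beta_min m bs = (INF (\<beta>, B) \<in> set (take m bs). ereal (\<beta> / B))"

definition alpha_min :: "nat \<Rightarrow> (real \<times> real) list \<Rightarrow> ereal" where
  "alpha_min n as = (INF (\<alpha>, A) \<in> set (take n as). ereal ((1 - \<alpha>) / A))"

end

theory Submission
  imports Defs "HOL-Probability.Characteristic_Functions" "HOL-Probability.Sinc_Integral"
begin

text \<open>
  Write \<open>\<Xi>\<^sub>1\<close>, \<open>\<Xi>\<^sub>2\<close>, \<open>\<Xi>\<^sub>3\<close> for the three kernels. The parameters are chosen such that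
  \<open>\<Xi>\<^sub>3(s) = \<Xi>\<^sub>1(s) \<Xi>\<^sub>2(\<omega> - \<Lambda> s)\<close>, and the bounds on \<open>\<omega>\<close> say exactly that there is a \<open>\<gamma>\<close> such that the lines
  \<open>Re s = \<gamma>\<close> and \<open>Re s = \<omega> - \<Lambda> \<gamma>\<close> separate the poles of \<open>\<Xi>\<^sub>1\<close> and of \<open>\<Xi>\<^sub>2\<close>, respectively. On such lines, after
  \<open>t = exp x\<close>, each \<open>H\<close>-function is a positive factor times the Fourier transform of its kernel.
  Fourier inversion for \<open>\<Xi>\<^sub>2\<close> turns the transform of the product into the convolution
  \<open>\<integral> h\<^sub>2(u) h\<^sub>1(x + \<Lambda> u) du\<close> of two positive functions.

  An \<open>H\<close>-function is defined by arbitrary contours. Given two of them, the arcs cut off at height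
  \<open>\<plusminus>T\<close> have, for large \<open>T\<close>, the same winding number about every pole, since both can be closed far away
  from a path that leads the pole to \<open>\<plusminus>\<infinity>\<close>. The homology form of Cauchy's theorem then shows that
  the integrals agree, because the kernel decays like \<open>exp (-\<pi>\<chi>\<bar>Im s\<bar>/2)\<close> up to smaller factors.
\<close>

section \<open>Decay of the Gamma factors in vertical strips\<close>

text \<open>\<open>fox_H\<close> is a definite description over all admissible contours, so its
  value is inaccessible until any two of them are known to give the same integral. Of an arbitrary
  contour only topological information is available, namely on which side a pole lies. This is why
  winding numbers replace an explicit deformation, and why they are compared only for large heights:
  how far a connecting path strays is not bounded in advance. The same independence pays off a
  second time. Fourier inversion needs the transform of the second kernel to be integrable, which
  the decay of the kernel itself does not give. But every admissible line Re s = c bounds |H (exp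
  x)| by a multiple of exp (- c x), and the admissible c form an open set. Neighbouring lines on
  both sides of the chosen one therefore control the transform in both directions. Positivity refers
  to the order of the complex numbers, where w > 0 includes that w is real; the convolution thus has
  a real and strictly positive integrand.\<close>

text \<open>
  Factor by factor in the Euler product, \<open>\<bar>\<Gamma>(\<sigma> + it)\<bar> / \<Gamma>(\<sigma>)\<close> increases with \<open>\<sigma> > 0\<close>.
  Together with the reflection formula this replaces Stirling's formula.
\<close>

lemma norm_Gamma_ratio_mono:
  fixes s :: complex and a :: real
  assumes "Re s > 0" "a \<ge> 0"
  shows "norm (Gamma s) * Gamma (Re s + a) \<le> norm (Gamma (s + of_real a)) * Gamma (Re s)"
proof -
  have poch: "norm (pochhammer (s + of_real a) n) * pochhammer (Re s) n
      \<le> norm (pochhammer s n) * pochhammer (Re s + a) n" for n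
  proof (induction n)
    case (Suc n)
    \<comment> \<open>After squaring, the common product of \<open>(Re s + n)^2\<close> and
      \<open>(Re s + a + n)^2\<close> cancels, and only the terms with \<open>(Im s)^2\<close>
      remain to be compared.\<close>
    have "norm (s + of_real a + of_nat n) * (Re s + n) \<le> norm (s + of_nat n) * (Re s + a + n)"
    proof (rule power2_le_imp_le)
      have "(Im s)\<^sup>2 * (Re s + n)\<^sup>2 \<le> (Im s)\<^sup>2 * (Re s + a + n)\<^sup>2"
        using assms by (intro mult_left_mono power_mono) auto
      then show "(norm (s + of_real a + of_nat n) * (Re s + n))\<^sup>2 \<le> (norm (s + of_nat n) * (Re s + a + n))\<^sup>2"
        unfolding power_mult_distrib cmod_power2 by (simp add: distrib_left distrib_right add_ac mult_ac)
      show "0 \<le> norm (s + of_nat n) * (Re s + a + n)"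
        using assms by auto
    qed
    from mult_mono[OF Suc.IH this] assms have "(norm (pochhammer (s + of_real a) n) * pochhammer (Re s) n) *
        (norm (s + of_real a + of_nat n) * (Re s + n))
      \<le> (norm (pochhammer s n) * pochhammer (Re s + a) n) * (norm (s + of_nat n) * (Re s + a + n))"
      by (simp add: pochhammer_nonneg)
    then show ?case
      by (simp add: pochhammer_Suc norm_mult mult_ac)
  qed auto
  have series: "norm (Gamma_series s n) * Gamma_series (Re s + a) n
      \<le> norm (Gamma_series (s + of_real a) n) * Gamma_series (Re s) n" for n
  proof -
    have pos: "norm (pochhammer s (n+1)) > 0" "norm (pochhammer (s + of_real a) (n+1)) > 0"
      "pochhammer (Re s) (n+1) > 0" "pochhammer (Re s + a) (n+1) > 0"
    proof -
      have "pochhammer z (n+1) \<noteq> 0" if "Re z > 0" for z :: complex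
        using that by (auto simp: pochhammer_eq_0_iff)
      from this[of s] this[of "s + of_real a"] assms
      show "norm (pochhammer s (n+1)) > 0" "norm (pochhammer (s + of_real a) (n+1)) > 0"
        by simp_all
      show "pochhammer (Re s) (n+1) > 0" "pochhammer (Re s + a) (n+1) > 0"
        using assms by (auto intro!: pochhammer_pos)
    qed
    \<comment> \<open>The numerator of an Euler approximant has a modulus that depends only on the
      real part of the argument. Both sides therefore have the numerator \<open>x * y\<close>, and
      the Pochhammer inequality enters inverted.\<close>
    define x where "x = fact n * exp (Re s * ln (real n))"
    define y where "y = fact n * exp ((Re s + a) * ln (real n))"
    have eqs: "norm (Gamma_series s n) = x / norm (pochhammer s (n+1))"
      "norm (Gamma_series (s + of_real a) n) = y / norm (pochhammer (s + of_real a) (n+1))"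
      "Gamma_series (Re s) n = x / pochhammer (Re s) (n+1)"
      "Gamma_series (Re s + a) n = y / pochhammer (Re s + a) (n+1)"
      unfolding Gamma_series_def x_def y_def by (simp_all add: norm_divide norm_mult)
    have "1 / (norm (pochhammer s (n+1)) * pochhammer (Re s + a) (n+1))
       \<le> 1 / (norm (pochhammer (s + of_real a) (n+1)) * pochhammer (Re s) (n+1))"
      using poch[of "n+1"] pos by (intro divide_left_mono) auto
    then have "x * y * (1 / (norm (pochhammer s (n+1)) * pochhammer (Re s + a) (n+1)))
       \<le> x * y * (1 / (norm (pochhammer (s + of_real a) (n+1)) * pochhammer (Re s) (n+1)))"
      by (intro mult_left_mono) (auto simp: x_def y_def)
    then show ?thesis
      unfolding eqs by (simp add: mult_ac)
  qed
  show ?thesis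
  proof (rule LIMSEQ_le)
    show "(\<lambda>n. norm (Gamma_series s n) * Gamma_series (Re s + a) n)
        \<longlonglongrightarrow> norm (Gamma s) * Gamma (Re s + a)"
      by (intro tendsto_intros)
    show "(\<lambda>n. norm (Gamma_series (s + of_real a) n) * Gamma_series (Re s) n)
        \<longlonglongrightarrow> norm (Gamma (s + of_real a)) * Gamma (Re s)"
      by (intro tendsto_intros)
  qed (use series in blast)
qed

text \<open>
  Decay at every exponential rate below \<open>c\<close>, locally uniformly in the real part: polynomial factors
  are invisible to this notion.
\<close>

definition strip_decay :: "(complex \<Rightarrow> complex) \<Rightarrow> real \<Rightarrow> bool" where
  "strip_decay f c \<longleftrightarrow> (\<forall>a b d. d < c \<longrightarrow>
     (\<exists>C T. \<forall>s. a \<le> Re s \<and> Re s \<le> b \<and> T \<le> \<bar>Im s\<bar> \<longrightarrow> norm (f s) \<le> C * exp (- d * \<bar>Im s\<bar>)))"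

lemma strip_decayE:
  assumes "strip_decay f c" "d < c"
  obtains C T where "C \<ge> 0" "T \<ge> 0"
    "\<And>s. a \<le> Re s \<Longrightarrow> Re s \<le> b \<Longrightarrow> T \<le> \<bar>Im s\<bar> \<Longrightarrow> norm (f s) \<le> C * exp (- d * \<bar>Im s\<bar>)"
proof -
  from assms obtain C T where CT: "\<And>s. a \<le> Re s \<Longrightarrow> Re s \<le> b \<Longrightarrow> T \<le> \<bar>Im s\<bar> \<Longrightarrow> norm (f s) \<le> C * exp (- d * \<bar>Im s\<bar>)"
    unfolding strip_decay_def by meson
  show thesis
  proof (rule that[of "max C 0" "max T 0"])
    fix s assume s: "a \<le> Re s" "Re s \<le> b" "max T 0 \<le> \<bar>Im s\<bar>"
    then have "norm (f s) \<le> C * exp (- d * \<bar>Im s\<bar>)" by (intro CT) auto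
    also have "\<dots> \<le> max C 0 * exp (- d * \<bar>Im s\<bar>)" by (intro mult_right_mono) auto
    finally show "norm (f s) \<le> max C 0 * exp (- d * \<bar>Im s\<bar>)" .
  qed auto
qed

lemma strip_decay_mult:
  assumes "strip_decay f c" "strip_decay g c'"
  shows "strip_decay (\<lambda>s. f s * g s) (c + c')"
  unfolding strip_decay_def
proof (intro allI impI)
  fix a b d :: real assume d: "d < c + c'"
  \<comment> \<open>Half of the slack goes to each factor, so that the rates \<open>c - e\<close>
    and \<open>c' - e\<close> add up to \<open>d\<close>.\<close>
  define e where "e = (c + c' - d) / 2"
  have e: "c - e < c" "c' - e < c'" using d by (auto simp: e_def)
  obtain C T where 1: "C \<ge> 0" "\<And>s. a \<le> Re s \<Longrightarrow> Re s \<le> b \<Longrightarrow> T \<le> \<bar>Im s\<bar> \<Longrightarrow> norm (f s) \<le> C * exp (- (c - e) * \<bar>Im s\<bar>)"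
    using strip_decayE[OF assms(1) e(1)] by metis
  obtain C' T' where 2: "C' \<ge> 0" "\<And>s. a \<le> Re s \<Longrightarrow> Re s \<le> b \<Longrightarrow> T' \<le> \<bar>Im s\<bar> \<Longrightarrow> norm (g s) \<le> C' * exp (- (c' - e) * \<bar>Im s\<bar>)"
    using strip_decayE[OF assms(2) e(2)] by metis
  show "\<exists>C T. \<forall>s. a \<le> Re s \<and> Re s \<le> b \<and> T \<le> \<bar>Im s\<bar> \<longrightarrow> norm (f s * g s) \<le> C * exp (- d * \<bar>Im s\<bar>)"
  proof (rule exI[of _ "C * C'"], rule exI[of _ "max T T'"], intro allI impI)
    fix s assume s: "a \<le> Re s \<and> Re s \<le> b \<and> max T T' \<le> \<bar>Im s\<bar>"
    then have "norm (f s) * norm (g s) \<le> (C * exp (- (c - e) * \<bar>Im s\<bar>)) * (C' * exp (- (c' - e) * \<bar>Im s\<bar>))"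
      using 1 2 by (intro mult_mono) auto
    also have "\<dots> = C * C' * exp (- (c - e) * \<bar>Im s\<bar> + - (c' - e) * \<bar>Im s\<bar>)"
      by (simp add: exp_add)
    also have "- (c - e) * \<bar>Im s\<bar> + - (c' - e) * \<bar>Im s\<bar> = - d * \<bar>Im s\<bar>"
      by (simp add: e_def field_simps)
    finally show "norm (f s * g s) \<le> C * C' * exp (- d * \<bar>Im s\<bar>)"
      by (simp add: norm_mult)
  qed
qed

lemma strip_decay_affine:
  fixes \<beta> :: complex and B :: real
  assumes "strip_decay f c" "B \<noteq> 0"
  shows "strip_decay (\<lambda>s. f (\<beta> + of_real B * s)) (\<bar>B\<bar> * c)"
  unfolding strip_decay_def
proof (intro allI impI)
  fix a b d :: real assume d: "d < \<bar>B\<bar> * c"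
  define M where "M = \<bar>Re \<beta>\<bar> + \<bar>B\<bar> * (\<bar>a\<bar> + \<bar>b\<bar>)"
  define e where "e = d / \<bar>B\<bar>"
  have "e < c" using d assms by (simp add: e_def field_simps)
  then obtain C T where CT: "C \<ge> 0" "\<And>s. -M \<le> Re s \<Longrightarrow> Re s \<le> M \<Longrightarrow> T \<le> \<bar>Im s\<bar> \<Longrightarrow> norm (f s) \<le> C * exp (- e * \<bar>Im s\<bar>)"
    using strip_decayE[OF assms(1)] by metis
  show "\<exists>C T. \<forall>s. a \<le> Re s \<and> Re s \<le> b \<and> T \<le> \<bar>Im s\<bar> \<longrightarrow> norm (f (\<beta> + of_real B * s)) \<le> C * exp (- d * \<bar>Im s\<bar>)"
  \<comment> \<open>The rate \<open>e\<close> may be negative, so the shift of the height by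
    \<open>Im \<beta>\<close> is paid for with \<open>|e|\<close> in the constant.\<close>
  proof (rule exI[of _ "C * exp (\<bar>e\<bar> * \<bar>Im \<beta>\<bar>)"], rule exI[of _ "(T + \<bar>Im \<beta>\<bar>) / \<bar>B\<bar>"], intro allI impI)
    fix s assume s: "a \<le> Re s \<and> Re s \<le> b \<and> (T + \<bar>Im \<beta>\<bar>) / \<bar>B\<bar> \<le> \<bar>Im s\<bar>"
    let ?w = "\<beta> + of_real B * s"
    have "\<bar>B * Re s\<bar> \<le> \<bar>B\<bar> * (\<bar>a\<bar> + \<bar>b\<bar>)"
      unfolding abs_mult using s by (intro mult_left_mono) auto
    then have "-M \<le> Re ?w" "Re ?w \<le> M" unfolding M_def by auto
    moreover have T: "T + \<bar>Im \<beta>\<bar> \<le> \<bar>B * Im s\<bar>"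
      using s assms by (simp add: abs_mult field_simps)
    then have "T \<le> \<bar>Im ?w\<bar>" by auto
    ultimately have "norm (f ?w) \<le> C * exp (- e * \<bar>Im ?w\<bar>)"
      by (intro CT)
    also have "\<bar>\<bar>Im ?w\<bar> - \<bar>B * Im s\<bar>\<bar> \<le> \<bar>Im \<beta>\<bar>" by auto
    then have "\<bar>e * (\<bar>Im ?w\<bar> - \<bar>B * Im s\<bar>)\<bar> \<le> \<bar>e\<bar> * \<bar>Im \<beta>\<bar>"
      unfolding abs_mult[of e] by (intro mult_left_mono) auto
    then have "- e * \<bar>Im ?w\<bar> \<le> \<bar>e\<bar> * \<bar>Im \<beta>\<bar> + - e * \<bar>B * Im s\<bar>"
      by (simp add: algebra_simps)
    then have "C * exp (- e * \<bar>Im ?w\<bar>) \<le> C * exp (\<bar>e\<bar> * \<bar>Im \<beta>\<bar> + - e * \<bar>B * Im s\<bar>)"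
      using CT(1) by (intro mult_left_mono) auto
    also have "- e * \<bar>B * Im s\<bar> = - d * \<bar>Im s\<bar>"
      using assms by (simp add: e_def abs_mult)
    finally show "norm (f ?w) \<le> C * exp (\<bar>e\<bar> * \<bar>Im \<beta>\<bar>) * exp (- d * \<bar>Im s\<bar>)"
      unfolding exp_add by (simp add: mult_ac)
  qed
qed

lemma strip_decay_const: "strip_decay (\<lambda>s. k) 0"
  unfolding strip_decay_def
proof (intro allI impI)
  fix a b d :: real assume "d < 0"
  then have "norm k * 1 \<le> norm k * exp (- d * \<bar>Im s\<bar>)" for s
    by (intro mult_left_mono) (auto intro: mult_nonpos_nonneg)
  then show "\<exists>C T. \<forall>s. a \<le> Re s \<and> Re s \<le> b \<and> T \<le> \<bar>Im s\<bar> \<longrightarrow> norm k \<le> C * exp (- d * \<bar>Im s\<bar>)"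
    by (intro exI[of _ "norm k"]) auto
qed

lemma strip_decay_ident: "strip_decay (\<lambda>s. s) 0"
  unfolding strip_decay_def
proof (intro allI impI)
  fix a b d :: real assume d: "d < 0"
  define M where "M = \<bar>a\<bar> + \<bar>b\<bar>"
  show "\<exists>C T. \<forall>s. a \<le> Re s \<and> Re s \<le> b \<and> T \<le> \<bar>Im s\<bar> \<longrightarrow> norm s \<le> C * exp (- d * \<bar>Im s\<bar>)"
  \<comment> \<open>\<open>M\<close> bounds the real part; \<open>1 / (-d)\<close> comes from
    \<open>x \<le> exp x\<close> at \<open>x = - d * |Im s|\<close>.\<close>
  proof (rule exI[of _ "M + 1 / (-d)"], rule exI[of _ 0], intro allI impI)
    fix s assume s: "a \<le> Re s \<and> Re s \<le> b \<and> 0 \<le> \<bar>Im s\<bar>"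
    have "norm s \<le> \<bar>Re s\<bar> + \<bar>Im s\<bar>" by (rule cmod_le)
    also have "\<dots> \<le> M + \<bar>Im s\<bar>" using s by (auto simp: M_def)
    also have "\<dots> \<le> M * exp (- d * \<bar>Im s\<bar>) + 1 / (-d) * exp (- d * \<bar>Im s\<bar>)"
    proof (rule add_mono)
      have "M * 1 \<le> M * exp (- d * \<bar>Im s\<bar>)"
        using d by (intro mult_left_mono) (auto simp: M_def intro: mult_nonpos_nonneg)
      then show "M \<le> M * exp (- d * \<bar>Im s\<bar>)" by simp
      have "-d * \<bar>Im s\<bar> \<le> exp (- d * \<bar>Im s\<bar>)"
        using exp_ge_add_one_self[of "-d * \<bar>Im s\<bar>"] by linarith
      then show "\<bar>Im s\<bar> \<le> 1 / (-d) * exp (- d * \<bar>Im s\<bar>)"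
        using d by (simp add: field_simps)
    qed
    finally show "norm s \<le> (M + 1 / (-d)) * exp (- d * \<bar>Im s\<bar>)"
      by (simp add: algebra_simps)
  qed
qed

lemma strip_decay_linear: "strip_decay (\<lambda>s. \<beta> + of_real B * s) 0"
proof (cases "B = 0")
  case False
  show ?thesis using strip_decay_affine[OF strip_decay_ident False] by simp
qed (simp add: strip_decay_const)

lemma strip_decay_pochhammer: "strip_decay (\<lambda>s. pochhammer (1 - s) n) 0"
proof (induction n)
  case (Suc n)
  from strip_decay_mult[OF Suc.IH strip_decay_linear[of "1 + of_nat n" "-1"]] show ?case
    by (simp add: pochhammer_Suc algebra_simps)
qed (simp add: strip_decay_const)

text \<open>The squared modulus is \<open>(cosh (2 * pi * Im s) - cos (2 * pi * Re s)) / 2\<close>.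
  For \<open>|Im s| \<ge> 1\<close> the growing exponential \<open>E\<close> is at least 7 and
  dominates the bounded terms.\<close>

lemma norm_sin_pi_bounds:
  fixes s :: complex
  assumes "\<bar>Im s\<bar> \<ge> 1"
  shows "norm (sin (of_real pi * s)) \<le> exp (pi * \<bar>Im s\<bar>)"
    and "exp (pi * \<bar>Im s\<bar>) / 4 \<le> norm (sin (of_real pi * s))"
proof -
  define E where "E = exp (2 * pi * \<bar>Im s\<bar>)"
  define c where "c = cos (2 * pi * Re s)"
  define F where "F = inverse E"
  have sq: "(norm (sin (of_real pi * s)))\<^sup>2 = (E + F - 2 * c) / 4"
  proof (cases "Im s \<ge> 0")
    case True
    then show ?thesis by (simp add: norm_sin_squared E_def F_def c_def mult_ac)
  next
    case False
    then show ?thesis by (simp add: norm_sin_squared E_def F_def c_def exp_minus mult_ac)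
  qed
  have "2 * 3 * 1 \<le> 2 * pi * \<bar>Im s\<bar>"
    using assms pi_gt3 by (intro mult_mono) auto
  then have "7 \<le> E"
    unfolding E_def using exp_ge_add_one_self[of "2 * pi * \<bar>Im s\<bar>"] by linarith
  have cos: "c \<le> 1" "c \<ge> -1" by (simp_all add: c_def)
  have inv: "0 \<le> F" "F \<le> 1"
    using \<open>7 \<le> E\<close> by (auto simp: F_def inverse_le_1_iff)
  have E: "(exp (pi * \<bar>Im s\<bar>))\<^sup>2 = E"
    by (simp add: E_def power2_eq_square mult_exp_exp)
  show "norm (sin (of_real pi * s)) \<le> exp (pi * \<bar>Im s\<bar>)"
  proof (rule power2_le_imp_le)
    have "(E + F - 2 * c) / 4 \<le> E"
      using cos inv \<open>7 \<le> E\<close> by (simp add: field_simps)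
    then show "(norm (sin (of_real pi * s)))\<^sup>2 \<le> (exp (pi * \<bar>Im s\<bar>))\<^sup>2"
      unfolding sq E .
  qed auto
  show "exp (pi * \<bar>Im s\<bar>) / 4 \<le> norm (sin (of_real pi * s))"
  proof (rule power2_le_imp_le)
    have "E / 16 \<le> (E + F - 2 * c) / 4"
      using cos inv \<open>7 \<le> E\<close> by (simp add: field_simps)
    then show "(exp (pi * \<bar>Im s\<bar>) / 4)\<^sup>2 \<le> (norm (sin (of_real pi * s)))\<^sup>2"
      by (simp add: sq E power_divide)
  qed auto
qed

text \<open>For \<open>M = 2 * N + 1\<close> and \<open>a = M - 2 * Re s\<close>, which is
  nonnegative in the strip, \<open>s + a\<close> is the complex conjugate of \<open>M - s\<close>.
  Monotonicity in the real part thus compares \<open>Gamma\<close> at \<open>s\<close> and at the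
  reflected point; \<open>C\<close> bounds the remaining quotient of real Gamma values on a compact
  interval.\<close>

lemma norm_Gamma_le_reflected:
  fixes N :: nat
  obtains C where "C \<ge> 0"
    "\<And>s. 1 \<le> Re s \<Longrightarrow> Re s \<le> N \<Longrightarrow> norm (Gamma s) \<le> C * norm (Gamma (of_nat (2*N+1) - s))"
proof -
  define M :: real where "M = 2 * N + 1"
  have "continuous_on {1..real N} (\<lambda>x. Gamma x / Gamma (M - x))"
  proof (intro continuous_at_imp_continuous_on ballI)
    fix x assume "x \<in> {1..real N}"
    then have "x > 0" "M - x > 0" by (auto simp: M_def)
    then have "x \<notin> \<int>\<^sub>\<le>\<^sub>0" "M - x \<notin> \<int>\<^sub>\<le>\<^sub>0" "Gamma (M - x) \<noteq> 0"
      by (auto simp: Gamma_eq_zero_iff elim!: nonpos_Ints_cases)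
    then show "isCont (\<lambda>x. Gamma x / Gamma (M - x)) x"
      by (intro continuous_intros) auto
  qed
  then have "bounded ((\<lambda>x. Gamma x / Gamma (M - x)) ` {1..real N})"
    by (intro compact_imp_bounded compact_continuous_image) auto
  then obtain C where C: "C > 0" "\<And>x. x \<in> {1..real N} \<Longrightarrow> norm (Gamma x / Gamma (M - x)) \<le> C"
    unfolding bounded_pos by blast
  show thesis
  proof (rule that[of C])
    fix s :: complex assume s: "1 \<le> Re s" "Re s \<le> N"
    define a where "a = M - 2 * Re s"
    have a: "a \<ge> 0" "Re s + a = M - Re s" using s by (auto simp: a_def M_def)
    have g: "Gamma (Re s) > 0" "Gamma (M - Re s) > 0"
      using s by (auto intro!: Gamma_real_pos simp: M_def)
    have "s + of_real a = cnj (of_real M - s)"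
      by (simp add: complex_eq_iff a_def)
    then have "norm (Gamma (s + of_real a)) = norm (Gamma (of_real M - s))"
      by (metis cnj_Gamma complex_mod_cnj)
    with norm_Gamma_ratio_mono[of s a] s a
    have "norm (Gamma s) * Gamma (M - Re s) \<le> norm (Gamma (of_real M - s)) * Gamma (Re s)"
      by simp
    then have "norm (Gamma s) \<le> (Gamma (Re s) / Gamma (M - Re s)) * norm (Gamma (of_real M - s))"
      using g by (simp add: field_simps)
    also have "\<dots> \<le> C * norm (Gamma (of_real M - s))"
      using C(2)[of "Re s"] s g by (intro mult_right_mono) auto
    finally show "norm (Gamma s) \<le> C * norm (Gamma (of_nat (2*N+1) - s))"
      by (simp add: M_def)
  qed (use C in auto)
qed

lemma not_nonpos_Int_of_Im: "Im s \<noteq> 0 \<Longrightarrow> s \<notin> \<int>\<^sub>\<le>\<^sub>0"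
  by (auto elim!: nonpos_Ints_cases)

text \<open>The square of \<open>|Gamma s|\<close> is bounded by a multiple of
  \<open>|Gamma s * Gamma (2 * N + 1 - s)|\<close>. Up to a polynomial factor this is
  \<open>|Gamma s * Gamma (1 - s)| = pi / |sin (pi * s)|\<close>, which decays at rate
  \<open>pi\<close>; the square root halves the rate.\<close>

lemma strip_decay_Gamma: "strip_decay Gamma (pi / 2)"
  unfolding strip_decay_def
proof (intro allI impI)
  fix a b d :: real assume d: "d < pi / 2"
  \<comment> \<open>\<open>k\<close> shifts the strip into \<open>Re s \<ge> 1\<close>, where the
    comparison with the reflected point is available, and \<open>N\<close> bounds the real part
    after the shift.\<close>
  define k where "k = nat \<lceil>1 - a\<rceil>"
  define N where "N = nat \<lceil>b + k\<rceil>"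
  have k: "1 \<le> a + k" unfolding k_def by linarith
  have N: "b + k \<le> N" unfolding N_def by linarith
  obtain C1 where C1: "C1 \<ge> 0"
    "\<And>s. 1 \<le> Re s \<Longrightarrow> Re s \<le> N \<Longrightarrow> norm (Gamma s) \<le> C1 * norm (Gamma (of_nat (2*N+1) - s))"
    using norm_Gamma_le_reflected by metis
  \<comment> \<open>The polynomial factor has rate 0, so the negative rate \<open>2 * d - pi\<close>
    is allowed for it. Together with the rate \<open>pi\<close> of the reflection formula it makes
    \<open>2 * d\<close>, the rate wanted for the square.\<close>
  have "2 * d - pi < 0" using d by simp
  from strip_decayE[OF strip_decay_pochhammer[of "2*N"] this, of 1 N]
  obtain C2 T where C2: "C2 \<ge> 0" "T \<ge> 0"
    "\<And>s. 1 \<le> Re s \<Longrightarrow> Re s \<le> N \<Longrightarrow> T \<le> \<bar>Im s\<bar> \<Longrightarrow>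
       norm (pochhammer (1 - s) (2*N)) \<le> C2 * exp (- (2 * d - pi) * \<bar>Im s\<bar>)"
    by blast
  define C where "C = sqrt (4 * pi * C1 * C2)"
  have C: "C \<ge> 0" "C\<^sup>2 = 4 * pi * C1 * C2" using C1 C2 by (auto simp: C_def)
  have main: "norm (Gamma s) \<le> C * exp (- d * \<bar>Im s\<bar>)"
    if s: "1 \<le> Re s" "Re s \<le> N" "max 1 T \<le> \<bar>Im s\<bar>" for s
  proof (rule power2_le_imp_le)
    have "norm (Gamma s * Gamma (1 - s)) = pi / norm (sin (of_real pi * s))"
      by (simp add: Gamma_reflection_complex norm_divide)
    also have "\<dots> \<le> pi / (exp (pi * \<bar>Im s\<bar>) / 4)"
      using norm_sin_pi_bounds(2)[of s] s
      by (intro divide_left_mono mult_pos_pos) (auto intro: less_le_trans[rotated])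
    also have "\<dots> = 4 * pi * exp (- pi * \<bar>Im s\<bar>)"
      by (simp add: exp_minus field_simps)
    finally have refl: "norm (Gamma s * Gamma (1 - s)) \<le> 4 * pi * exp (- pi * \<bar>Im s\<bar>)" .
    have "Im s \<noteq> 0" using s by auto
    then have nonpos: "1 - s \<notin> \<int>\<^sub>\<le>\<^sub>0" by (intro not_nonpos_Int_of_Im) auto
    then have "Gamma (1 - s) \<noteq> 0" by (simp add: Gamma_eq_zero_iff)
    with pochhammer_Gamma[OF nonpos, of "2*N"]
    have "Gamma (of_nat (2*N+1) - s) = pochhammer (1 - s) (2*N) * Gamma (1 - s)"
      by (simp add: algebra_simps)
    then have "(norm (Gamma s))\<^sup>2
        \<le> norm (Gamma s) * (C1 * (norm (pochhammer (1 - s) (2*N)) * norm (Gamma (1 - s))))"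
      using C1(2)[of s] s unfolding power2_eq_square by (intro mult_left_mono) (auto simp: norm_mult)
    also have "\<dots> = C1 * norm (pochhammer (1 - s) (2*N)) * norm (Gamma s * Gamma (1 - s))"
      by (simp add: norm_mult mult_ac)
    also have "\<dots> \<le> C1 * (C2 * exp (- (2 * d - pi) * \<bar>Im s\<bar>)) * (4 * pi * exp (- pi * \<bar>Im s\<bar>))"
      using C1(1) C2 s refl by (intro mult_mono mult_nonneg_nonneg) auto
    also have "\<dots> = C\<^sup>2 * (exp (- (2 * d - pi) * \<bar>Im s\<bar>) * exp (- pi * \<bar>Im s\<bar>))"
      by (simp add: C)
    also have "exp (- (2 * d - pi) * \<bar>Im s\<bar>) * exp (- pi * \<bar>Im s\<bar>) = (exp (- d * \<bar>Im s\<bar>))\<^sup>2"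
      by (simp add: power2_eq_square mult_exp_exp algebra_simps)
    also have "C\<^sup>2 * (exp (- d * \<bar>Im s\<bar>))\<^sup>2 = (C * exp (- d * \<bar>Im s\<bar>))\<^sup>2"
      by (simp only: power_mult_distrib)
    finally show "(norm (Gamma s))\<^sup>2 \<le> (C * exp (- d * \<bar>Im s\<bar>))\<^sup>2" .
  qed (use C in auto)
  show "\<exists>C T. \<forall>s. a \<le> Re s \<and> Re s \<le> b \<and> T \<le> \<bar>Im s\<bar> \<longrightarrow> norm (Gamma s) \<le> C * exp (- d * \<bar>Im s\<bar>)"
  proof (rule exI[of _ C], rule exI[of _ "max 1 T"], intro allI impI)
    fix s assume s: "a \<le> Re s \<and> Re s \<le> b \<and> max 1 T \<le> \<bar>Im s\<bar>"
    have "Im s \<noteq> 0" using s by auto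
    then have nonpos: "s \<notin> \<int>\<^sub>\<le>\<^sub>0" by (intro not_nonpos_Int_of_Im)
    then have "Gamma s \<noteq> 0" by (simp add: Gamma_eq_zero_iff)
    with pochhammer_Gamma[OF nonpos, of k]
    have eq: "Gamma (s + of_nat k) = pochhammer s k * Gamma s" by simp
    \<comment> \<open>Each factor \<open>s + i\<close> has modulus at least
      \<open>|Im s| \<ge> 1\<close>, so going back to the left by the functional equation only makes
      Gamma smaller.\<close>
    have "1 \<le> norm (pochhammer s k)"
      unfolding pochhammer_prod prod_norm[symmetric]
    proof (rule prod_ge_1)
      fix i
      have "1 \<le> \<bar>Im (s + of_nat i)\<bar>" using s by auto
      then show "1 \<le> norm (s + of_nat i)" using abs_Im_le_cmod order_trans by blast
    qed
    then have "1 * norm (Gamma s) \<le> norm (pochhammer s k) * norm (Gamma s)"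
      by (intro mult_right_mono) auto
    also have "\<dots> = norm (Gamma (s + of_nat k))" by (simp add: eq norm_mult)
    also have "\<dots> \<le> C * exp (- d * \<bar>Im (s + of_nat k)\<bar>)"
      using s k N by (intro main) auto
    finally show "norm (Gamma s) \<le> C * exp (- d * \<bar>Im s\<bar>)" by simp
  qed
qed

lemma strip_decay_sin_pi: "strip_decay (\<lambda>s. sin (of_real pi * s)) (- pi)"
  unfolding strip_decay_def
proof (intro allI impI)
  fix a b d :: real assume d: "d < - pi"
  show "\<exists>C T. \<forall>s. a \<le> Re s \<and> Re s \<le> b \<and> T \<le> \<bar>Im s\<bar> \<longrightarrow>
      norm (sin (complex_of_real pi * s)) \<le> C * exp (- d * \<bar>Im s\<bar>)"
  proof (intro exI[of _ 1] allI impI)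
    fix s assume s: "a \<le> Re s \<and> Re s \<le> b \<and> 1 \<le> \<bar>Im s\<bar>"
    then have "norm (sin (complex_of_real pi * s)) \<le> exp (pi * \<bar>Im s\<bar>)"
      by (intro norm_sin_pi_bounds) auto
    also have "pi * \<bar>Im s\<bar> \<le> -d * \<bar>Im s\<bar>" using d by (intro mult_right_mono) auto
    finally show "norm (sin (complex_of_real pi * s)) \<le> 1 * exp (- d * \<bar>Im s\<bar>)" by simp
  qed
qed

lemma strip_decay_cong_off_real:
  assumes "strip_decay f c" "\<And>s. Im s \<noteq> 0 \<Longrightarrow> f s = g s"
  shows "strip_decay g c"
  unfolding strip_decay_def
proof (intro allI impI)
  fix a b d :: real assume "d < c"
  then obtain C T where CT: "T \<ge> 0"
    "\<And>s. a \<le> Re s \<Longrightarrow> Re s \<le> b \<Longrightarrow> T \<le> \<bar>Im s\<bar> \<Longrightarrow> norm (f s) \<le> C * exp (- d * \<bar>Im s\<bar>)"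
    using strip_decayE[OF assms(1)] by metis
  show "\<exists>C T. \<forall>s. a \<le> Re s \<and> Re s \<le> b \<and> T \<le> \<bar>Im s\<bar> \<longrightarrow> norm (g s) \<le> C * exp (- d * \<bar>Im s\<bar>)"
  proof (rule exI[of _ C], rule exI[of _ "T + 1"], intro allI impI)
    fix s assume s: "a \<le> Re s \<and> Re s \<le> b \<and> T + 1 \<le> \<bar>Im s\<bar>"
    then have "Im s \<noteq> 0" using CT(1) by auto
    with CT(2)[of s] s assms(2)[of s] show "norm (g s) \<le> C * exp (- d * \<bar>Im s\<bar>)" by auto
  qed
qed

text \<open>By reflection \<open>1 / Gamma s\<close> is
  \<open>Gamma (1 - s) * sin (pi * s) / pi\<close>, of rate \<open>pi / 2 - pi\<close>. At the
  positive integers this formula yields 0 by the convention for \<open>Gamma\<close>, hence the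
  restriction to points off the real axis.\<close>

lemma strip_decay_rGamma: "strip_decay rGamma (- pi / 2)"
proof (rule strip_decay_cong_off_real)
  have "strip_decay (\<lambda>s. Gamma (1 + of_real (-1) * s) * sin (of_real pi * s) * of_real (1 / pi)) (\<bar>-1\<bar> * (pi / 2) + - pi + 0)"
    by (intro strip_decay_mult strip_decay_affine strip_decay_Gamma strip_decay_sin_pi strip_decay_const) auto
  then show "strip_decay (\<lambda>s. Gamma (1 + of_real (-1) * s) * sin (of_real pi * s) * of_real (1 / pi)) (- pi / 2)"
    by simp
  fix s :: complex assume "Im s \<noteq> 0"
  then have "1 - s \<notin> \<int>\<^sub>\<le>\<^sub>0" by (intro not_nonpos_Int_of_Im) auto
  then have "rGamma (1 - s) * Gamma (1 - s) = 1"
    by (simp add: rGamma_inverse_Gamma Gamma_eq_zero_iff)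
  then have "rGamma s = rGamma s * rGamma (1 - s) * Gamma (1 - s)"
    by (simp add: mult.assoc)
  then show "Gamma (1 + of_real (-1) * s) * sin (of_real pi * s) * of_real (1 / pi) = rGamma s"
    by (simp add: rGamma_reflection_complex mult_ac)
qed


section \<open>Decay and poles of the kernel\<close>

lemma strip_decay_prod_list:
  assumes "\<And>x. x \<in> set xs \<Longrightarrow> strip_decay (f x) (c x)"
  shows "strip_decay (\<lambda>s. \<Prod>x\<leftarrow>xs. f x s) (\<Sum>x\<leftarrow>xs. c x)"
  using assms by (induction xs) (auto intro: strip_decay_mult strip_decay_const)

lemma holomorphic_on_prod_list:
  assumes "\<And>x. x \<in> set xs \<Longrightarrow> f x holomorphic_on S"
  shows "(\<lambda>s. \<Prod>x\<leftarrow>xs. f x s) holomorphic_on S"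
  using assms by (induction xs) (auto intro!: holomorphic_intros)

text \<open>With \<open>Gamma\<close> equal to 0 at its poles and \<open>inverse 0 = 0\<close>,
  \<open>inverse (Gamma z)\<close> is \<open>rGamma z\<close> for every \<open>z\<close>. The
  denominator thus contributes entire factors, and only the numerator can create
  singularities.\<close>

lemma fox_Xi_altdef:
  "fox_Xi m n as bs s =
     ((\<Prod>(\<beta>, B)\<leftarrow>take m bs. Gamma (\<beta> + of_real B * s)) *
      (\<Prod>(\<alpha>, A)\<leftarrow>take n as. Gamma (1 - \<alpha> + of_real (- A) * s))) *
     ((\<Prod>(\<beta>, B)\<leftarrow>drop m bs. rGamma (1 - \<beta> + of_real (- B) * s)) *
      (\<Prod>(\<alpha>, A)\<leftarrow>drop n as. rGamma (\<alpha> + of_real A * s)))"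
proof -
  have inv: "inverse (prod_list zs) = prod_list (map inverse zs)" for zs :: "complex list"
    by (induction zs) auto
  show ?thesis
    unfolding fox_Xi_def divide_inverse inverse_mult_distrib inv
    by (simp add: o_def case_prod_unfold rGamma_inverse_Gamma)
qed

lemma strip_decay_fox_Xi:
  assumes "\<And>\<alpha> A. (\<alpha>, A) \<in> set as \<Longrightarrow> A > 0" "\<And>\<beta> B. (\<beta>, B) \<in> set bs \<Longrightarrow> B > 0"
  shows "strip_decay (fox_Xi m n as bs) (pi / 2 * fox_chi m n as bs)"
proof -
  have pos: "snd x > 0" if "x \<in> set (take k as) \<or> x \<in> set (drop k as) \<or> x \<in> set (take k bs) \<or> x \<in> set (drop k bs)" for x k
    using that assms by (cases x) (auto dest: in_set_takeD in_set_dropD)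
  have lin: "strip_decay (\<lambda>s. f (g (fst x) + of_real (e * snd x) * s)) (snd x * c)"
    if "strip_decay f c" "\<bar>e\<bar> = 1" "snd x > 0" for f g e c and x :: "complex \<times> real"
    using strip_decay_affine[OF that(1), of "e * snd x" "g (fst x)"] that(2,3)
    by (auto simp: abs_mult)
  note D = strip_decay_prod_list[OF lin]
  \<comment> \<open>\<open>id\<close> and the factors \<open>1\<close> and \<open>- 1\<close> bring
    all four products into the single shape treated in \<open>lin\<close>.\<close>
  have "strip_decay (\<lambda>s.
     ((\<Prod>x\<leftarrow>take m bs. Gamma (id (fst x) + of_real (1 * snd x) * s)) *
      (\<Prod>x\<leftarrow>take n as. Gamma (1 - fst x + of_real (- 1 * snd x) * s))) *
     ((\<Prod>x\<leftarrow>drop m bs. rGamma (1 - fst x + of_real (- 1 * snd x) * s)) *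
      (\<Prod>x\<leftarrow>drop n as. rGamma (id (fst x) + of_real (1 * snd x) * s))))
     (((\<Sum>x\<leftarrow>take m bs. snd x * (pi / 2)) + (\<Sum>x\<leftarrow>take n as. snd x * (pi / 2))) +
      ((\<Sum>x\<leftarrow>drop m bs. snd x * (- pi / 2)) + (\<Sum>x\<leftarrow>drop n as. snd x * (- pi / 2))))"
    using pos by (intro strip_decay_mult D strip_decay_Gamma strip_decay_rGamma) auto
  note decay = this
  have rate: "(((\<Sum>x\<leftarrow>take m bs. snd x * (pi / 2)) + (\<Sum>x\<leftarrow>take n as. snd x * (pi / 2))) +
      ((\<Sum>x\<leftarrow>drop m bs. snd x * (- pi / 2)) + (\<Sum>x\<leftarrow>drop n as. snd x * (- pi / 2))))
      = pi / 2 * fox_chi m n as bs"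
    unfolding fox_chi_def sum_list_mult_const by (simp add: case_prod_unfold algebra_simps)
  show ?thesis
    using decay unfolding rate fox_Xi_altdef[abs_def] case_prod_unfold by simp
qed

text \<open>Poles of the numerator factors, even where a reciprocal Gamma factor cancels them in the
  kernel: these are the points that a contour has to separate.\<close>

definition fox_poles :: "nat \<Rightarrow> nat \<Rightarrow> (complex \<times> real) list \<Rightarrow> (complex \<times> real) list \<Rightarrow> complex set" where
  "fox_poles m n as bs =
     {s. (\<exists>(\<beta>, B) \<in> set (take m bs). \<beta> + of_real B * s \<in> \<int>\<^sub>\<le>\<^sub>0) \<or>
         (\<exists>(\<alpha>, A) \<in> set (take n as). 1 - \<alpha> - of_real A * s \<in> \<int>\<^sub>\<le>\<^sub>0)}"

lemma holomorphic_on_fox_Xi: "fox_Xi m n as bs holomorphic_on - fox_poles m n as bs"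
proof -
  have "(\<lambda>s. case x of (\<beta>, B) \<Rightarrow> Gamma (\<beta> + of_real B * s)) holomorphic_on - fox_poles m n as bs"
    if x: "x \<in> set (take m bs)" for x
  proof -
    have "fst x + of_real (snd x) * s \<notin> \<int>\<^sub>\<le>\<^sub>0" if "s \<in> - fox_poles m n as bs" for s
      using that x unfolding fox_poles_def case_prod_unfold by blast
    then show ?thesis
      unfolding case_prod_unfold by (intro holomorphic_intros)
  qed
  moreover have "(\<lambda>s. case x of (\<alpha>, A) \<Rightarrow> Gamma (1 - \<alpha> + of_real (- A) * s)) holomorphic_on - fox_poles m n as bs"
    if x: "x \<in> set (take n as)" for x
  proof -
    have "1 - fst x - of_real (snd x) * s \<notin> \<int>\<^sub>\<le>\<^sub>0" if "s \<in> - fox_poles m n as bs" for s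
      using that x unfolding fox_poles_def case_prod_unfold by blast
    then show ?thesis
      unfolding case_prod_unfold by (intro holomorphic_intros) simp
  qed
  moreover have "(\<lambda>s. case x of (\<beta>, B) \<Rightarrow> rGamma (1 - \<beta> + of_real (- B) * s)) holomorphic_on S"
    "(\<lambda>s. case x of (\<alpha>, A) \<Rightarrow> rGamma (\<alpha> + of_real A * s)) holomorphic_on S" for x S
    by (cases x; auto intro!: holomorphic_intros)+
  ultimately show ?thesis
    unfolding fox_Xi_altdef by (intro holomorphic_on_mult holomorphic_on_prod_list)
qed

lemma finite_affine_nonpos_Ints_strip:
  fixes \<beta> :: complex and B :: real
  assumes "B \<noteq> 0"
  shows "finite {s. \<beta> + of_real B * s \<in> \<int>\<^sub>\<le>\<^sub>0 \<and> \<bar>Re s\<bar> \<le> X}"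
proof (rule finite_subset)
  define N where "N = nat \<lceil>\<bar>Re \<beta>\<bar> + \<bar>B\<bar> * X\<rceil>"
  show "finite ((\<lambda>k. (- of_nat k - \<beta>) / of_real B) ` {..N})" by simp
  show "{s. \<beta> + of_real B * s \<in> \<int>\<^sub>\<le>\<^sub>0 \<and> \<bar>Re s\<bar> \<le> X} \<subseteq> (\<lambda>k. (- of_nat k - \<beta>) / of_real B) ` {..N}"
  proof safe
    fix s assume s: "\<beta> + of_real B * s \<in> \<int>\<^sub>\<le>\<^sub>0" "\<bar>Re s\<bar> \<le> X"
    from s(1) obtain k where k: "\<beta> + of_real B * s = - of_nat k" by (elim nonpos_Ints_cases')
    then have "Re (\<beta> + of_real B * s) = - real k" by simp
    then have "real k \<le> \<bar>Re \<beta>\<bar> + \<bar>B * Re s\<bar>" by simp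
    also have "\<bar>B * Re s\<bar> \<le> \<bar>B\<bar> * X" unfolding abs_mult using s by (intro mult_left_mono) auto
    finally have "k \<le> N" unfolding N_def by linarith
    moreover have "s = (- of_nat k - \<beta>) / of_real B"
      using k assms by (simp add: field_simps)
    ultimately show "s \<in> (\<lambda>k. (- of_nat k - \<beta>) / of_real B) ` {..N}" by blast
  qed
qed

lemma finite_fox_poles_strip:
  assumes "\<And>\<alpha> A. (\<alpha>, A) \<in> set as \<Longrightarrow> A > 0" "\<And>\<beta> B. (\<beta>, B) \<in> set bs \<Longrightarrow> B > 0"
  shows "finite {s \<in> fox_poles m n as bs. \<bar>Re s\<bar> \<le> X}"
proof (rule finite_subset)
  let ?P = "\<lambda>\<beta> B. {s. \<beta> + of_real B * s \<in> \<int>\<^sub>\<le>\<^sub>0 \<and> \<bar>Re s\<bar> \<le> X}"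
  show "finite ((\<Union>x\<in>set (take m bs). ?P (fst x) (snd x)) \<union> (\<Union>x\<in>set (take n as). ?P (1 - fst x) (- snd x)))"
    using assms by (intro finite_UnI finite_UN_I finite_affine_nonpos_Ints_strip)
      (force dest: in_set_takeD)+
  show "{s \<in> fox_poles m n as bs. \<bar>Re s\<bar> \<le> X} \<subseteq>
     (\<Union>x\<in>set (take m bs). ?P (fst x) (snd x)) \<union> (\<Union>x\<in>set (take n as). ?P (1 - fst x) (- snd x))"
    unfolding fox_poles_def case_prod_unfold by auto
qed

lemma is_pole_Gamma_affine_iff:
  fixes \<beta> :: complex and B :: real
  assumes "B \<noteq> 0"
  shows "is_pole (\<lambda>u. Gamma (\<beta> + of_real B * u)) s \<longleftrightarrow> \<beta> + of_real B * s \<in> \<int>\<^sub>\<le>\<^sub>0"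
proof
  assume pole: "is_pole (\<lambda>u. Gamma (\<beta> + of_real B * u)) s"
  show "\<beta> + of_real B * s \<in> \<int>\<^sub>\<le>\<^sub>0"
  proof (rule ccontr)
    assume "\<beta> + of_real B * s \<notin> \<int>\<^sub>\<le>\<^sub>0"
    then have "isCont (\<lambda>u. Gamma (\<beta> + of_real B * u)) s"
      by (intro continuous_intros) auto
    then have "(\<lambda>u. Gamma (\<beta> + of_real B * u)) \<midarrow>s\<rightarrow> Gamma (\<beta> + of_real B * s)"
      by (simp add: isCont_def)
    with pole show False
      unfolding is_pole_def using not_tendsto_and_filterlim_at_infinity by (metis at_neq_bot)
  qed
next
  assume "\<beta> + of_real B * s \<in> \<int>\<^sub>\<le>\<^sub>0"
  then obtain k where k: "\<beta> + of_real B * s = - of_nat k" by (elim nonpos_Ints_cases')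
  have "filterlim (\<lambda>u. \<beta> + of_real B * u) (at (- of_nat k)) (at s)"
  proof (rule filterlim_atI)
    show "((\<lambda>u. \<beta> + of_real B * u) \<longlongrightarrow> - of_nat k) (at s)"
      unfolding k[symmetric] by (intro tendsto_intros)
    show "\<forall>\<^sub>F u in at s. \<beta> + of_real B * u \<noteq> - of_nat k"
      using assms by (auto simp: eventually_at_filter k[symmetric])
  qed
  from filterlim_compose[OF is_pole_Gamma[unfolded is_pole_def] this]
  show "is_pole (\<lambda>u. Gamma (\<beta> + of_real B * u)) s"
    unfolding is_pole_def .
qed

section \<open>Independence of the contour\<close>

definition contour_segment :: "(real \<Rightarrow> complex) \<Rightarrow> real \<Rightarrow> real \<Rightarrow> complex" where
  "contour_segment g T x = g (2 * T * x - T)"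

text \<open>
  The horizontal pieces lead to the imaginary axis, so that arcs that belong to contours with
  different abscissae have common end points.
\<close>

definition contour_arc :: "real \<Rightarrow> (real \<Rightarrow> complex) \<Rightarrow> real \<Rightarrow> real \<Rightarrow> complex" where
  "contour_arc \<gamma> g T =
     linepath (Complex 0 (- T)) (Complex \<gamma> (- T)) +++ contour_segment g T +++
     linepath (Complex \<gamma> T) (Complex 0 T)"

text \<open>It starts and ends on the imaginary axis, so that the same detour closes the arcs of all
  contours, whatever their abscissae.\<close>

definition closing_path :: "real \<Rightarrow> real \<Rightarrow> real \<Rightarrow> complex" where
  "closing_path c T =
     linepath (Complex 0 T) (Complex c T) +++ linepath (Complex c T) (Complex c (- T)) +++
     linepath (Complex c (- T)) (Complex 0 (- T))"

lemma vertical_contour_eventually_line: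
  assumes "vertical_contour \<gamma> g"
  obtains T0 where "T0 > 0" "\<And>y. T0 \<le> \<bar>y\<bar> \<Longrightarrow> g y = Complex \<gamma> y"
proof -
  from assms obtain a b where a: "\<And>y. y \<le> a \<Longrightarrow> g y = Complex \<gamma> y" and b: "\<And>y. y \<ge> b \<Longrightarrow> g y = Complex \<gamma> y"
    unfolding vertical_contour_def eventually_at_bot_linorder eventually_at_top_linorder by blast
  show thesis
  proof (rule that[of "max 1 (max (- a) b)"])
    fix y assume "max 1 (max (- a) b) \<le> \<bar>y\<bar>"
    then have "y \<le> a \<or> y \<ge> b" by linarith
    then show "g y = Complex \<gamma> y" using a b by blast
  qed auto
qed

lemma vertical_contour_Re_bounded:
  assumes "vertical_contour \<gamma> g"
  obtains X where "X \<ge> \<bar>\<gamma>\<bar>" "\<And>y. \<bar>Re (g y)\<bar> \<le> X"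
proof -
  obtain T0 where T0: "T0 > 0" "\<And>y. T0 \<le> \<bar>y\<bar> \<Longrightarrow> g y = Complex \<gamma> y"
    using vertical_contour_eventually_line[OF assms] by blast
  have "continuous_on {-T0..T0} g"
    using assms unfolding vertical_contour_def piecewise_C1_differentiable_on_def
    by (auto intro: continuous_on_subset)
  then have "bounded (g ` {-T0..T0})"
    by (intro compact_imp_bounded compact_continuous_image) auto
  then obtain B where B: "\<And>y. y \<in> {-T0..T0} \<Longrightarrow> norm (g y) \<le> B"
    unfolding bounded_iff by blast
  show thesis
  proof (rule that[of "max \<bar>\<gamma>\<bar> B"])
    fix y
    show "\<bar>Re (g y)\<bar> \<le> max \<bar>\<gamma>\<bar> B"
    proof (cases "T0 \<le> \<bar>y\<bar>")
      case True
      then show ?thesis by (simp add: T0)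
    next
      case False
      then have "norm (g y) \<le> B" by (intro B) auto
      then show ?thesis using abs_Re_le_cmod[of "g y"] by linarith
    qed
  qed auto
qed

lemma closed_range_vertical_contour:
  assumes "vertical_contour \<gamma> g"
  shows "closed (range g)"
proof -
  obtain T0 where T0: "T0 > 0" "\<And>y. T0 \<le> \<bar>y\<bar> \<Longrightarrow> g y = Complex \<gamma> y"
    using vertical_contour_eventually_line[OF assms] by blast
  have "continuous_on {-T0..T0} g"
    using assms unfolding vertical_contour_def piecewise_C1_differentiable_on_def
    by (auto intro: continuous_on_subset)
  then have "closed (g ` {-T0..T0})"
    by (intro compact_imp_closed compact_continuous_image) auto
  moreover have "closed ({z. Re z = \<gamma>} \<inter> {z. T0 \<le> \<bar>Im z\<bar>})"
    by (intro closed_Int closed_Collect_eq closed_Collect_le continuous_intros)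
  moreover have "range g = g ` {-T0..T0} \<union> ({z. Re z = \<gamma>} \<inter> {z. T0 \<le> \<bar>Im z\<bar>})"
  proof (intro equalityI subsetI)
    fix z assume "z \<in> range g"
    then obtain y where y: "z = g y" by blast
    show "z \<in> g ` {-T0..T0} \<union> ({z. Re z = \<gamma>} \<inter> {z. T0 \<le> \<bar>Im z\<bar>})"
    proof (cases "T0 \<le> \<bar>y\<bar>")
      case False
      then have "y \<in> {-T0..T0}" by auto
      then show ?thesis using y by blast
    qed (use T0(2)[of y] y in auto)
  next
    fix z assume "z \<in> g ` {-T0..T0} \<union> ({z. Re z = \<gamma>} \<inter> {z. T0 \<le> \<bar>Im z\<bar>})"
    then consider "z \<in> g ` {-T0..T0}" | "Re z = \<gamma>" "T0 \<le> \<bar>Im z\<bar>" by blast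
    then show "z \<in> range g"
    proof cases
      case 2
      then have "z = g (Im z)" by (simp add: T0 complex_eq_iff)
      then show ?thesis by blast
    qed auto
  qed
  ultimately show ?thesis by (metis closed_Un)
qed

lemma valid_path_contour_segment:
  assumes "vertical_contour \<gamma> g"
  shows "valid_path (contour_segment g T)"
proof -
  have "g piecewise_C1_differentiable_on ((\<lambda>x. 2 * T * x + - T) ` {0..1})"
    using assms unfolding vertical_contour_def by (blast intro: piecewise_C1_differentiable_on_subset)
  from piecewise_C1_differentiable_affine[OF this] show ?thesis
    by (simp add: valid_path_def contour_segment_def[abs_def] o_def)
qed

lemma path_image_contour_segment: "path_image (contour_segment g T) \<subseteq> range g"
  by (auto simp: path_image_def contour_segment_def)

lemma contour_segment_ends [simp]:
  "pathstart (contour_segment g T) = g (- T)" "pathfinish (contour_segment g T) = g T"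
  by (simp_all add: pathstart_def pathfinish_def contour_segment_def)

lemma has_contour_integral_segment:
  assumes g: "vertical_contour \<gamma> g" and "T > 0"
    and I: "((\<lambda>y. F (g y) * vector_derivative g (at y)) has_integral I) {-T..T}"
  shows "(F has_contour_integral I) (contour_segment g T)"
proof -
  let ?h = "\<lambda>y. F (g y) * vector_derivative g (at y)"
  from g obtain S where S: "finite S" "g C1_differentiable_on (UNIV - S)"
    unfolding vertical_contour_def piecewise_C1_differentiable_on_def by blast
  have "((\<lambda>x. ?h ((2 * T) *\<^sub>R x + - T)) has_integral I /\<^sub>R (2 * T) ^ DIM(real))
      (cbox ((- T - - T) /\<^sub>R (2 * T)) ((T - - T) /\<^sub>R (2 * T)))"
    using I \<open>T > 0\<close> by (intro has_integral_affinity') auto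
  then have "((\<lambda>x. ?h (2 * T * x - T)) has_integral I /\<^sub>R (2 * T)) {0..1}"
    using \<open>T > 0\<close> by (simp add: field_simps)
  from has_integral_cmul[OF this, of "2 * T"]
  have *: "((\<lambda>x. (2 * T) *\<^sub>R ?h (2 * T * x - T)) has_integral I) {0..1}"
    using \<open>T > 0\<close> by simp
  show ?thesis
    unfolding has_contour_integral
  proof (rule has_integral_spike_finite[OF _ _ *])
    show "finite ((\<lambda>x. 2 * T * x - T) -` S)"
      using S(1) \<open>T > 0\<close> by (intro finite_vimageI) (auto simp: inj_on_def)
    fix x assume "x \<in> {0..1} - (\<lambda>x. 2 * T * x - T) -` S"
    then have "g differentiable (at (2 * T * x - T))"
      using S(2) by (auto simp: C1_differentiable_on_eq)
    then have "(g has_vector_derivative vector_derivative g (at (2 * T * x - T))) (at (2 * T * x - T))"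
      by (simp add: vector_derivative_works)
    moreover have "((\<lambda>x. 2 * T * x - T) has_vector_derivative (2 * T)) (at x)"
      by (auto intro!: derivative_eq_intros simp: has_real_derivative_iff_has_vector_derivative[symmetric])
    ultimately have "(g \<circ> (\<lambda>x. 2 * T * x - T) has_vector_derivative
        (2 * T) *\<^sub>R vector_derivative g (at (2 * T * x - T))) (at x)"
      by (intro vector_diff_chain_at) auto
    then have "vector_derivative (contour_segment g T) (at x) =
        (2 * T) *\<^sub>R vector_derivative g (at (2 * T * x - T))"
      unfolding contour_segment_def[abs_def] o_def by (rule vector_derivative_at)
    then show "F (contour_segment g T x) * vector_derivative (contour_segment g T) (at x) =
        (2 * T) *\<^sub>R ?h (2 * T * x - T)"
      by (simp add: contour_segment_def scaleR_conv_of_real mult_ac)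
  qed
qed

text \<open>The integral along the whole contour may converge only conditionally. Its definition
  controls all sufficiently large intervals, in particular the symmetric ones.\<close>

lemma segment_integral_tendsto:
  assumes g: "vertical_contour \<gamma> g" and I: "has_vertical_contour_integral F I g"
  shows "((\<lambda>T. contour_integral (contour_segment g T) F) \<longlongrightarrow> I) at_top"
    and "T > 0 \<Longrightarrow> F contour_integrable_on contour_segment g T"
proof -
  let ?h = "\<lambda>y. F (g y) * vector_derivative g (at y)"
  have int: "?h integrable_on {a..b}" for a b
    using I unfolding has_vertical_contour_integral_def has_integral_alt'[of _ _ UNIV] by simp
  have has: "(F has_contour_integral (integral {-T..T} ?h)) (contour_segment g T)" if "T > 0" for T
    using has_contour_integral_segment[OF g that] int by (meson integrable_integral)
  then show "T > 0 \<Longrightarrow> F contour_integrable_on contour_segment g T"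
    by (auto simp: contour_integrable_on_def)
  show "((\<lambda>T. contour_integral (contour_segment g T) F) \<longlongrightarrow> I) at_top"
  proof (rule tendstoI)
    fix e :: real assume "e > 0"
    then obtain B where B: "B > 0" "\<And>a b. ball 0 B \<subseteq> cbox a b \<Longrightarrow> norm (integral (cbox a b) ?h - I) < e"
      using I unfolding has_vertical_contour_integral_def has_integral_alt'[of _ _ UNIV] by auto
    show "\<forall>\<^sub>F T in at_top. dist (contour_integral (contour_segment g T) F) I < e"
      using eventually_gt_at_top[of B]
    proof eventually_elim
      case (elim T)
      have "ball 0 B \<subseteq> cbox (- T) T" using elim by (auto simp: dist_real_def)
      then have "norm (integral {-T..T} ?h - I) < e" using B(2)[of "- T" T] by simp
      moreover have "contour_integral (contour_segment g T) F = integral {-T..T} ?h"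
        using has elim B(1) by (intro contour_integral_unique) auto
      ultimately show ?case by (simp add: dist_norm)
    qed
  qed
qed

lemma closed_segment_horizontal:
  assumes "s \<in> closed_segment (Complex a y) (Complex b y)"
  shows "Im s = y \<and> Re s \<in> closed_segment a b"
proof -
  obtain u where u: "0 \<le> u" "u \<le> 1" "s = (1 - u) *\<^sub>R Complex a y + u *\<^sub>R Complex b y"
    using assms by (auto simp: closed_segment_def)
  then have "Re s = (1 - u) * a + u * b" "Im s = y" by (simp_all add: left_diff_distrib)
  with u show ?thesis by (auto simp: closed_segment_def)
qed

lemma closed_segment_vertical:
  assumes "s \<in> closed_segment (Complex a y) (Complex a y')"
  shows "Re s = a"
proof -
  obtain u where "s = (1 - u) *\<^sub>R Complex a y + u *\<^sub>R Complex a y'"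
    using assms by (auto simp: closed_segment_def)
  then show ?thesis by (simp add: left_diff_distrib)
qed

lemma horizontal_integral_tendsto_0:
  assumes decay: "strip_decay F c" "c > 0" and e: "\<bar>e\<bar> = 1"
  shows "((\<lambda>T. contour_integral (linepath (Complex a (e * T)) (Complex b (e * T))) F) \<longlongrightarrow> 0) at_top"
proof -
  define d where "d = c / 2"
  have d: "0 < d" "d < c" using decay by (auto simp: d_def)
  obtain C T0 where CT: "C \<ge> 0" "T0 \<ge> 0"
    "\<And>s. min a b \<le> Re s \<Longrightarrow> Re s \<le> max a b \<Longrightarrow> T0 \<le> \<bar>Im s\<bar> \<Longrightarrow> norm (F s) \<le> C * exp (- d * \<bar>Im s\<bar>)"
    using strip_decayE[OF decay(1) d(2)] by metis
  have "filterlim (\<lambda>T. d * T) at_top at_top"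
    using d by (intro filterlim_tendsto_pos_mult_at_top[OF tendsto_const]) (auto intro: filterlim_ident)
  then have "filterlim (\<lambda>T. - d * T) at_bot at_top"
    by (simp add: filterlim_uminus_at_bot)
  then have "((\<lambda>T. C * exp (- d * T) * \<bar>b - a\<bar>) \<longlongrightarrow> C * 0 * \<bar>b - a\<bar>) at_top"
    by (intro tendsto_intros filterlim_compose[OF exp_at_bot])
  then have lim: "((\<lambda>T. C * exp (- d * T) * \<bar>b - a\<bar>) \<longlongrightarrow> 0) at_top"
    by simp
  show ?thesis
  proof (rule Lim_null_comparison[OF _ lim])
    show "\<forall>\<^sub>F T in at_top. norm (contour_integral (linepath (Complex a (e * T)) (Complex b (e * T))) F)
        \<le> C * exp (- d * T) * \<bar>b - a\<bar>"
      using eventually_ge_at_top[of "max T0 1"]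
    proof eventually_elim
      case (elim T)
      let ?p = "linepath (Complex a (e * T)) (Complex b (e * T))"
      have "norm (contour_integral ?p F) \<le> C * exp (- d * T) * norm (Complex b (e * T) - Complex a (e * T))"
      proof (cases "F contour_integrable_on ?p")
        case True
        then show ?thesis
        proof (rule contour_integral_bound_linepath)
          fix s assume "s \<in> closed_segment (Complex a (e * T)) (Complex b (e * T))"
          then have Re: "Re s \<in> closed_segment a b" and Im: "Im s = e * T"
            using closed_segment_horizontal by blast+
          then have "min a b \<le> Re s" "Re s \<le> max a b" by (auto simp: closed_segment_eq_real_ivl split: if_splits)
          moreover have "\<bar>Im s\<bar> = T" using elim e by (simp add: Im abs_mult)
          ultimately show "norm (F s) \<le> C * exp (- d * T)"
            using CT(3)[of s] elim by simp
        qed (use CT in auto)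
      next
        \<comment> \<open>The contour integral is 0 by convention here, so the bound holds as
          well.\<close>
        case False
        then show ?thesis using CT by (simp add: not_integrable_contour_integral)
      qed
      also have "norm (Complex b (e * T) - Complex a (e * T)) = \<bar>b - a\<bar>"
        by (simp add: complex_diff cmod_def)
      finally show ?case .
    qed
  qed
qed

lemma valid_path_contour_arc:
  assumes "vertical_contour \<gamma> g" "g T = Complex \<gamma> T" "g (- T) = Complex \<gamma> (- T)"
  shows "valid_path (contour_arc \<gamma> g T)" "pathstart (contour_arc \<gamma> g T) = Complex 0 (- T)"
    "pathfinish (contour_arc \<gamma> g T) = Complex 0 T"
    "path_image (contour_arc \<gamma> g T) =
       closed_segment (Complex 0 (- T)) (Complex \<gamma> (- T)) \<union> path_image (contour_segment g T) \<union>
       closed_segment (Complex \<gamma> T) (Complex 0 T)"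
  using assms valid_path_contour_segment[OF assms(1)]
  by (auto simp: contour_arc_def path_image_join intro!: valid_path_join)

lemma valid_path_closing_path:
  "valid_path (closing_path c T)" "pathstart (closing_path c T) = Complex 0 T"
  "pathfinish (closing_path c T) = Complex 0 (- T)"
  "path_image (closing_path c T) =
       closed_segment (Complex 0 T) (Complex c T) \<union> closed_segment (Complex c T) (Complex c (- T)) \<union>
       closed_segment (Complex c (- T)) (Complex 0 (- T))"
  by (auto simp: closing_path_def path_image_join intro!: valid_path_join)

text \<open>
  \<open>H\<close> connects \<open>w\<close> to a point \<open>x\<close> outside the loop \<open>p +++ q\<close> without meeting it.
\<close>

lemma winding_number_closing:
  assumes p: "path p" "pathstart p = pathfinish q" "pathfinish p = pathstart q" and q: "path q"
    and C: "convex C" "path_image p \<subseteq> C" "path_image q \<subseteq> C" "x \<notin> C"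
    and H: "connected H" "w \<in> H" "x \<in> H" "H \<inter> path_image p = {}" "H \<inter> path_image q = {}"
  shows "winding_number p w = - winding_number q w"
proof -
  have image: "path_image (p +++ q) = path_image p \<union> path_image q"
    using p by (simp add: path_image_join)
  have path: "path (p +++ q)" and loop: "pathfinish (p +++ q) = pathstart (p +++ q)"
    using p q by auto
  \<comment> \<open>The index of the loop is constant along \<open>H\<close> and vanishes at
    \<open>x\<close>, which lies outside a convex set that contains the loop.\<close>
  have "winding_number (p +++ q) constant_on H"
    using path loop H(1) by (rule winding_number_constant) (use H image in auto)
  with H have "winding_number (p +++ q) w = winding_number (p +++ q) x"
    by (auto simp: constant_on_def)
  also have "winding_number (p +++ q) x = 0"
    using path C(1) loop C(4) by (rule winding_number_zero_outside) (use C image in auto)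
  also have "winding_number (p +++ q) w = winding_number p w + winding_number q w"
    using p q H by (intro winding_number_join) auto
  finally show ?thesis by (simp add: eq_neg_iff_add_eq_0)
qed

text \<open>
  A pole on the left is joined to a point near \<open>-\<infinity>\<close>, so the arc is closed far to the right
  (\<open>e = 1\<close>); a pole on the right needs \<open>e = -1\<close>. The right-hand side does not depend on \<open>g\<close>.
\<close>

lemma eventually_winding_number_contour_arc:
  assumes g: "vertical_contour \<gamma> g" and e: "\<bar>e\<bar> = 1"
    and w: "\<And>X. \<exists>x. connected_component (- range g) w (of_real x) \<and> e * x < - X"
  shows "\<forall>\<^sub>F T in at_top. w \<notin> path_image (contour_arc \<gamma> g T) \<and>
     winding_number (contour_arc \<gamma> g T) w = - winding_number (closing_path (e * T) T) w"
proof -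
  obtain X where X: "X \<ge> \<bar>\<gamma>\<bar>" "\<And>y. \<bar>Re (g y)\<bar> \<le> X"
    using vertical_contour_Re_bounded[OF g] by blast
  obtain T0 where T0: "T0 > 0" "\<And>y. T0 \<le> \<bar>y\<bar> \<Longrightarrow> g y = Complex \<gamma> y"
    using vertical_contour_eventually_line[OF g] by blast
  obtain x where x: "connected_component (- range g) w (of_real x)" "e * x < - X"
    using w by blast
  \<comment> \<open>In an open set connected components are path components. A connecting path is
    compact, and some radius \<open>R\<close> confines it.\<close>
  have "open (- range g)" using closed_range_vertical_contour[OF g] by auto
  then have "path_component (- range g) w (of_real x)"
    using x(1) by (metis open_path_connected_component)
  then obtain h where h: "path h" "path_image h \<subseteq> - range g" "pathstart h = w" "pathfinish h = of_real x"
    unfolding path_component_def by blast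
  obtain R where R: "R > 0" "\<And>s. s \<in> path_image h \<Longrightarrow> norm s < R"
    using bounded_path_image[OF h(1)] unfolding bounded_pos_less by blast
  have e': "e = 1 \<or> e = -1" using e by linarith
  have eX: "\<bar>e * a\<bar> \<le> X" if "\<bar>a\<bar> \<le> X" for a using that e by (simp add: abs_mult)
  \<comment> \<open>A half-plane that will contain the arc and its closing path, but not
    \<open>x\<close>, because \<open>e * x < - X\<close>.\<close>
  define C where "C = {s. e * Re s \<ge> - X}"
  have convex: "convex C"
  proof -
    have "C = {s. inner (Complex e 0) s \<ge> - X}" by (auto simp: C_def inner_complex_def)
    then show ?thesis by (simp add: convex_halfspace_ge)
  qed
  have "X \<ge> 0" using X by linarith
  show ?thesis
    using eventually_ge_at_top[of "max T0 R"]
  proof eventually_elim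
    case (elim T)
    then have T: "T \<ge> T0" "T \<ge> R" "T > 0" using R by auto
    have gT: "g T = Complex \<gamma> T" "g (- T) = Complex \<gamma> (- T)"
      using T T0(1) by (auto intro!: T0(2))
    note arc = valid_path_contour_arc[OF g gT]
    \<comment> \<open>The horizontal pieces and the far side of the closing path have distance at
      least \<open>T \<ge> R\<close> from 0, so \<open>h\<close> misses them; it misses the rest of
      the arc because it avoids \<open>range g\<close>.\<close>
    have off: "s \<notin> path_image h" if "\<bar>Re s\<bar> \<ge> T \<or> \<bar>Im s\<bar> \<ge> T" for s
      using that abs_Re_le_cmod[of s] abs_Im_le_cmod[of s] R(2)[of s] T by fastforce
    have in_C: "closed_segment a b \<subseteq> C" if "a \<in> C" "b \<in> C" for a b
      using that convex by (rule closed_segment_subset)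
    have H1: "path_image h \<inter> path_image (contour_arc \<gamma> g T) = {}"
    proof -
      have "s \<notin> path_image (contour_arc \<gamma> g T)" if "s \<in> path_image h" for s
        using that off[of s] h(2) path_image_contour_segment[of g T] T(3)
        by (auto simp: arc dest!: closed_segment_horizontal)
      then show ?thesis by blast
    qed
    have H2: "path_image h \<inter> path_image (closing_path (e * T) T) = {}"
    proof -
      have "s \<notin> path_image (closing_path (e * T) T)" if "s \<in> path_image h" for s
        using that off[of s] e T(3)
        by (auto simp: valid_path_closing_path abs_mult dest!: closed_segment_horizontal closed_segment_vertical)
      then show ?thesis by blast
    qed
    have C1: "path_image (contour_arc \<gamma> g T) \<subseteq> C"
    proof -
      have "path_image (contour_segment g T) \<subseteq> C"
      proof
        fix s assume "s \<in> path_image (contour_segment g T)"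
        then obtain y where "s = g y" using path_image_contour_segment by blast
        then show "s \<in> C" using eX[OF X(2)[of y]] by (simp add: C_def abs_le_iff)
      qed
      moreover have "Complex 0 t \<in> C" "Complex \<gamma> t \<in> C" for t
        using \<open>X \<ge> 0\<close> eX[of \<gamma>] X(1) by (auto simp: C_def)
      ultimately show ?thesis unfolding arc by (intro Un_least in_C) auto
    qed
    have C2: "path_image (closing_path (e * T) T) \<subseteq> C"
    proof -
      have "Complex 0 t \<in> C" "Complex (e * T) t \<in> C" for t
        using \<open>X \<ge> 0\<close> T(3) e' by (auto simp: C_def)
      then show ?thesis unfolding valid_path_closing_path by (intro Un_least in_C) auto
    qed
    have "winding_number (contour_arc \<gamma> g T) w = - winding_number (closing_path (e * T) T) w"
    proof (rule winding_number_closing[OF _ _ _ _ convex C1 C2 _ _ _ _ H1 H2])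
      show "of_real x \<notin> C" using x by (simp add: C_def)
      show "connected (path_image h)" using h by (simp add: connected_path_image)
      show "w \<in> path_image h" "of_real x \<in> path_image h"
        using h by (metis pathstart_in_path_image, metis pathfinish_in_path_image)
    qed (simp_all add: arc valid_path_closing_path valid_path_imp_path)
    moreover have "w \<in> path_image h" using h by (metis pathstart_in_path_image)
    ultimately show ?case using H1 by blast
  qed
qed

lemma left_of_contourD:
  assumes "w \<in> left_of_contour g"
  shows "\<exists>x. connected_component (- range g) w (of_real x) \<and> 1 * x < - X"
proof -
  have "\<forall>\<^sub>F x in at_bot. connected_component (- range g) w (of_real x) \<and> x < - X"
    using assms unfolding left_of_contour_def by (intro eventually_conj eventually_gt_at_bot) auto
  then show ?thesis
    using eventually_happens'[OF trivial_limit_at_bot_linorder] by fastforce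
qed

lemma right_of_contourD:
  assumes "w \<in> right_of_contour g"
  shows "\<exists>x. connected_component (- range g) w (of_real x) \<and> (- 1) * x < - X"
proof -
  have "\<forall>\<^sub>F x in at_top. connected_component (- range g) w (of_real x) \<and> x > X"
    using assms unfolding right_of_contour_def by (intro eventually_conj eventually_gt_at_top) auto
  then show ?thesis
    using eventually_happens'[OF trivial_limit_at_top_linorder] by fastforce
qed

lemma vertical_contour_integral_unique:
  assumes holo: "F holomorphic_on - P" and fin: "\<And>X. finite {s \<in> P. \<bar>Re s\<bar> \<le> X}"
    and decay: "strip_decay F c" "c > 0"
    and g1: "vertical_contour \<gamma>1 g1" and g2: "vertical_contour \<gamma>2 g2"
    and sep: "\<And>w. w \<in> P \<Longrightarrow> w \<in> left_of_contour g1 \<inter> left_of_contour g2 \<or>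
      w \<in> right_of_contour g1 \<inter> right_of_contour g2"
    and I1: "has_vertical_contour_integral F I1 g1" and I2: "has_vertical_contour_integral F I2 g2"
  shows "I1 = I2"
proof -
  obtain X1 where X1: "X1 \<ge> \<bar>\<gamma>1\<bar>" "\<And>y. \<bar>Re (g1 y)\<bar> \<le> X1"
    using vertical_contour_Re_bounded[OF g1] by blast
  obtain X2 where X2: "X2 \<ge> \<bar>\<gamma>2\<bar>" "\<And>y. \<bar>Re (g2 y)\<bar> \<le> X2"
    using vertical_contour_Re_bounded[OF g2] by blast
  obtain T1 where T1: "\<And>y. T1 \<le> \<bar>y\<bar> \<Longrightarrow> g1 y = Complex \<gamma>1 y"
    using vertical_contour_eventually_line[OF g1] by blast
  obtain T2 where T2: "\<And>y. T2 \<le> \<bar>y\<bar> \<Longrightarrow> g2 y = Complex \<gamma>2 y"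
    using vertical_contour_eventually_line[OF g2] by blast
  \<comment> \<open>The added 1 puts both contours into the open strip \<open>V\<close> of
    half-width \<open>X\<close>.\<close>
  define X where "X = max X1 X2 + 1"
  have X: "\<bar>\<gamma>1\<bar> < X" "\<bar>\<gamma>2\<bar> < X" "\<bar>Re (g1 y)\<bar> < X" "\<bar>Re (g2 y)\<bar> < X" for y
    using X1(1) X2(1) X1(2)[of y] X2(2)[of y] by (auto simp: X_def)
  define Q where "Q = {s \<in> P. \<bar>Re s\<bar> \<le> X}"
  define V where "V = {s. \<bar>Re s\<bar> < X}"
  define S where "S = V - Q"
  have "finite Q" unfolding Q_def by (rule fin)
  have V: "open V" "convex V"
  proof -
    show "open V" unfolding V_def by (intro open_Collect_less continuous_intros)
    have "V = {s. Re s < X} \<inter> {s. Re s > - X}" by (auto simp: V_def)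
    then show "convex V" by (simp add: convex_Int convex_halfspace_Re_lt convex_halfspace_Re_gt)
  qed
  have S: "open S" unfolding S_def using V \<open>finite Q\<close> by (intro open_Diff finite_imp_closed)
  have holS: "F holomorphic_on S"
    using holo by (rule holomorphic_on_subset) (auto simp: S_def V_def Q_def)

  have wind: "\<forall>\<^sub>F T in at_top. w \<notin> path_image (contour_arc \<gamma>1 g1 T) \<and> w \<notin> path_image (contour_arc \<gamma>2 g2 T) \<and>
      winding_number (contour_arc \<gamma>1 g1 T) w = winding_number (contour_arc \<gamma>2 g2 T) w"
    if "w \<in> Q" for w
  proof -
    obtain e :: real where e: "\<bar>e\<bar> = 1"
      "\<And>X. \<exists>x. connected_component (- range g1) w (of_real x) \<and> e * x < - X"
      "\<And>X. \<exists>x. connected_component (- range g2) w (of_real x) \<and> e * x < - X"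
    proof (cases "w \<in> left_of_contour g1 \<inter> left_of_contour g2")
      case True
      then show ?thesis using left_of_contourD by (intro that[of 1]) auto
    next
      case False
      then have "w \<in> right_of_contour g1 \<inter> right_of_contour g2"
        using sep[of w] \<open>w \<in> Q\<close> by (auto simp: Q_def)
      then show ?thesis using right_of_contourD by (intro that[of "-1"]) auto
    qed
    show ?thesis
      using eventually_winding_number_contour_arc[OF g1 e(1,2)]
        eventually_winding_number_contour_arc[OF g2 e(1,3)]
      by eventually_elim auto
  qed
  \<comment> \<open>Every pole has its own threshold for \<open>T\<close>; the finitely many poles
    in the strip admit a common one.\<close>
  have wind_ball: "\<forall>\<^sub>F T in at_top. \<forall>w\<in>Q. w \<notin> path_image (contour_arc \<gamma>1 g1 T) \<and>
      w \<notin> path_image (contour_arc \<gamma>2 g2 T) \<and>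
      winding_number (contour_arc \<gamma>1 g1 T) w = winding_number (contour_arc \<gamma>2 g2 T) w"
    using \<open>finite Q\<close> wind by (intro eventually_ball_finite) auto
  \<comment> \<open>The truncated integrals differ by four horizontal ones, with the heights written
    as \<open>1 * T\<close> and \<open>- 1 * T\<close> to fit the estimate at height
    \<open>e * T\<close>.\<close>
  have diff: "\<forall>\<^sub>F T in at_top. contour_integral (contour_segment g1 T) F - contour_integral (contour_segment g2 T) F =
      contour_integral (linepath (Complex 0 (- 1 * T)) (Complex \<gamma>2 (- 1 * T))) F
      + contour_integral (linepath (Complex \<gamma>2 (1 * T)) (Complex 0 (1 * T))) F
      - contour_integral (linepath (Complex 0 (- 1 * T)) (Complex \<gamma>1 (- 1 * T))) F
      - contour_integral (linepath (Complex \<gamma>1 (1 * T)) (Complex 0 (1 * T))) F"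
    using wind_ball eventually_gt_at_top[of "max (max T1 T2) 0"]
  proof eventually_elim
    case (elim T)
    have T: "T > 0" "T > T1" "T > T2" using elim(2) by auto
    have ends: "g1 T = Complex \<gamma>1 T" "g1 (- T) = Complex \<gamma>1 (- T)"
      "g2 T = Complex \<gamma>2 T" "g2 (- T) = Complex \<gamma>2 (- T)"
      using T by (auto intro!: T1 T2)
    note arc1 = valid_path_contour_arc[OF g1 ends(1,2)]
    note arc2 = valid_path_contour_arc[OF g2 ends(3,4)]
    have seg: "closed_segment a b \<subseteq> V" if "a \<in> V" "b \<in> V" for a b
      using that V(2) by (rule closed_segment_subset)
    have inV: "Complex 0 t \<in> V" "Complex \<gamma>1 t \<in> V" "Complex \<gamma>2 t \<in> V" "g1 t \<in> V" "g2 t \<in> V" for t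
      using X by (auto simp: V_def)
    have "path_image (contour_segment g1 T) \<subseteq> V" "path_image (contour_segment g2 T) \<subseteq> V"
      using path_image_contour_segment inV(4,5) by blast+
    then have subV: "path_image (contour_arc \<gamma>1 g1 T) \<subseteq> V" "path_image (contour_arc \<gamma>2 g2 T) \<subseteq> V"
      unfolding arc1 arc2 by (simp_all add: seg inV)
    then have subS: "path_image (contour_arc \<gamma>1 g1 T) \<subseteq> S" "path_image (contour_arc \<gamma>2 g2 T) \<subseteq> S"
      using elim(1) by (auto simp: S_def)
    let ?L = "contour_arc \<gamma>1 g1 T +++ reversepath (contour_arc \<gamma>2 g2 T)"
    have L: "valid_path ?L" "pathfinish ?L = pathstart ?L"
      "path_image ?L = path_image (contour_arc \<gamma>1 g1 T) \<union> path_image (contour_arc \<gamma>2 g2 T)"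
      using arc1 arc2 by (auto simp: path_image_join intro!: valid_path_join)
    have "(F has_contour_integral 0) ?L"
    proof (rule Cauchy_theorem_global[OF S holS L(1,2)])
      show "path_image ?L \<subseteq> S" using subS by (simp add: L)
      fix w assume "w \<notin> S"
      show "winding_number ?L w = 0"
      \<comment> \<open>Outside the convex strip the index is 0, so poles there do no harm; at a
        pole inside it the indices of the two arcs cancel.\<close>
      proof (cases "w \<in> V")
        case False
        show ?thesis
          using valid_path_imp_path[OF L(1)] V(2) L(2) False
          by (rule winding_number_zero_outside) (use subV L in auto)
      next
        case True
        then have "w \<in> Q" using \<open>w \<notin> S\<close> by (auto simp: S_def)
        with elim(1) have "w \<notin> path_image (contour_arc \<gamma>1 g1 T)" "w \<notin> path_image (contour_arc \<gamma>2 g2 T)"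
          "winding_number (contour_arc \<gamma>1 g1 T) w = winding_number (contour_arc \<gamma>2 g2 T) w" by blast+
        then show ?thesis
          using arc1 arc2 by (simp add: winding_number_join winding_number_reversepath valid_path_imp_path)
      qed
    qed
    then have "contour_integral ?L F = 0" by (rule contour_integral_unique)
    moreover have int: "F contour_integrable_on p" if "valid_path p" "path_image p \<subseteq> S" for p
      using contour_integrable_holomorphic_simple[OF holS S that] .
    ultimately have eq: "contour_integral (contour_arc \<gamma>1 g1 T) F = contour_integral (contour_arc \<gamma>2 g2 T) F"
      using arc1 arc2 subS
      by (simp add: contour_integral_reversepath contour_integrable_reversepath)
    have split: "contour_integral (contour_arc \<gamma> g T) F =
        contour_integral (linepath (Complex 0 (- T)) (Complex \<gamma> (- T))) F +
        (contour_integral (contour_segment g T) F +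
        contour_integral (linepath (Complex \<gamma> T) (Complex 0 T)) F)"
      if g: "vertical_contour \<gamma> g" and ends: "g T = Complex \<gamma> T" "g (- T) = Complex \<gamma> (- T)"
        and sub: "path_image (contour_arc \<gamma> g T) \<subseteq> S" for \<gamma> g
    proof -
      have "F contour_integrable_on linepath (Complex 0 (- T)) (Complex \<gamma> (- T))"
        "F contour_integrable_on contour_segment g T"
        "F contour_integrable_on linepath (Complex \<gamma> T) (Complex 0 T)"
        using sub valid_path_contour_segment[OF g] unfolding valid_path_contour_arc[OF g ends]
        by (auto intro!: int)
      then show ?thesis
        using ends valid_path_contour_segment[OF g]
        by (auto simp: contour_arc_def intro!: contour_integrable_joinI valid_path_join)
    qed
    show ?case
      using eq unfolding split[OF g1 ends(1,2) subS(1)] split[OF g2 ends(3,4) subS(2)]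
      by (simp add: algebra_simps)
  qed
  have "((\<lambda>T. contour_integral (contour_segment g1 T) F - contour_integral (contour_segment g2 T) F)
      \<longlongrightarrow> 0 + 0 - 0 - 0) at_top"
    unfolding tendsto_cong[OF diff]
    by (intro tendsto_add tendsto_diff horizontal_integral_tendsto_0[OF decay]) simp_all
  moreover have "((\<lambda>T. contour_integral (contour_segment g1 T) F - contour_integral (contour_segment g2 T) F)
      \<longlongrightarrow> I1 - I2) at_top"
    using segment_integral_tendsto(1)[OF g1 I1] segment_integral_tendsto(1)[OF g2 I2]
    by (rule tendsto_diff)
  ultimately have "I1 - I2 = 0 + 0 - 0 - 0"
    using tendsto_unique trivial_limit_at_top_linorder by blast
  then show ?thesis by simp
qed

section \<open>Integration along a vertical line\<close>

lemma vertical_contour_line: "vertical_contour \<gamma> (Complex \<gamma>)"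
proof -
  have "(Complex \<gamma> has_vector_derivative \<i>) (at y)" for y
    unfolding has_vector_derivative_complex_iff by (auto intro!: derivative_eq_intros)
  then have "Complex \<gamma> C1_differentiable_on UNIV"
    unfolding C1_differentiable_on_def by (intro exI[of _ "\<lambda>_. \<i>"]) auto
  then show ?thesis
    by (auto simp: vertical_contour_def inj_def intro: C1_differentiable_imp_piecewise)
qed

lemma continuous_on_line: "continuous_on S (Complex \<gamma>)"
proof -
  have "Complex \<gamma> = (\<lambda>y. of_real \<gamma> + \<i> * of_real y)" by (auto simp: complex_eq_iff)
  then show ?thesis by (auto intro!: continuous_intros)
qed

lemma vector_derivative_line: "vector_derivative (Complex \<gamma>) (at y) = \<i>"
  by (rule vector_derivative_at)
    (auto simp: has_vector_derivative_complex_iff intro!: derivative_eq_intros)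

lemma left_of_line: "Re s < \<gamma> \<Longrightarrow> s \<in> left_of_contour (Complex \<gamma>)"
proof -
  assume s: "Re s < \<gamma>"
  have "\<forall>\<^sub>F x in at_bot. x < \<gamma>" by (rule eventually_gt_at_bot)
  then have "\<forall>\<^sub>F x in at_bot. connected_component (- range (Complex \<gamma>)) s (complex_of_real x)"
  proof eventually_elim
    case (elim x)
    show ?case
      by (rule connected_componentI[of "{z. Re z < \<gamma>}"])
        (use s elim in \<open>auto intro: convex_connected convex_halfspace_Re_lt\<close>)
  qed
  then show ?thesis by (simp add: left_of_contour_def)
qed

lemma right_of_line: "Re s > \<gamma> \<Longrightarrow> s \<in> right_of_contour (Complex \<gamma>)"
proof -
  assume s: "Re s > \<gamma>"
  have "\<forall>\<^sub>F x in at_top. x > \<gamma>" by (rule eventually_gt_at_top)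
  then have "\<forall>\<^sub>F x in at_top. connected_component (- range (Complex \<gamma>)) s (complex_of_real x)"
  proof eventually_elim
    case (elim x)
    show ?case
      by (rule connected_componentI[of "{z. Re z > \<gamma>}"])
        (use s elim in \<open>auto intro: convex_connected convex_halfspace_Re_gt\<close>)
  qed
  then show ?thesis by (simp add: right_of_contour_def)
qed

text \<open>On such a line all numerator Gamma factors have arguments with positive real part. For
  positive \<open>A\<close> and \<open>B\<close> this means that the line itself separates the two
  families of poles.\<close>

definition admissible_line :: "nat \<Rightarrow> nat \<Rightarrow> (complex \<times> real) list \<Rightarrow> (complex \<times> real) list \<Rightarrow> real \<Rightarrow> bool" where
  "admissible_line m n as bs \<gamma> \<longleftrightarrow>
     (\<forall>(\<beta>, B) \<in> set (take m bs). Re \<beta> + B * \<gamma> > 0) \<and>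
     (\<forall>(\<alpha>, A) \<in> set (take n as). 1 - Re \<alpha> - A * \<gamma> > 0)"

definition positive_params :: "(complex \<times> real) list \<Rightarrow> bool" where
  "positive_params as \<longleftrightarrow> (\<forall>(\<alpha>, A) \<in> set as. A > 0)"

lemma nonpos_Ints_Re_le_0: "s \<in> \<int>\<^sub>\<le>\<^sub>0 \<Longrightarrow> Re s \<le> 0"
  by (auto elim!: nonpos_Ints_cases)

lemma admissible_line_disjoint_poles:
  assumes "admissible_line m n as bs \<gamma>"
  shows "Complex \<gamma> y \<notin> fox_poles m n as bs"
  using assms nonpos_Ints_Re_le_0 unfolding fox_poles_def admissible_line_def case_prod_unfold
  by fastforce

lemma separates_poles_line:
  assumes "admissible_line m n as bs \<gamma>" "positive_params as" "positive_params bs"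
  shows "separates_poles m n as bs (Complex \<gamma>)"
proof -
  have "s \<in> left_of_contour (Complex \<gamma>)"
    if "(\<beta>, B) \<in> set (take m bs)" "is_pole (\<lambda>u. Gamma (\<beta> + of_real B * u)) s" for \<beta> B s
  proof -
    have "B > 0" "Re \<beta> + B * \<gamma> > 0"
      using that(1) assms by (auto simp: admissible_line_def positive_params_def dest: in_set_takeD)
    moreover from that(2) \<open>B > 0\<close> have "Re \<beta> + B * Re s \<le> 0"
      using nonpos_Ints_Re_le_0[of "\<beta> + of_real B * s"] by (simp add: is_pole_Gamma_affine_iff)
    ultimately have "B * Re s < B * \<gamma>" by linarith
    then show ?thesis using \<open>B > 0\<close> by (intro left_of_line) simp
  qed
  moreover have "s \<in> right_of_contour (Complex \<gamma>)"
    if "(\<alpha>, A) \<in> set (take n as)" "is_pole (\<lambda>u. Gamma (1 - \<alpha> - of_real A * u)) s" for \<alpha> A s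
  proof -
    have "A > 0" "1 - Re \<alpha> - A * \<gamma> > 0"
      using that(1) assms by (auto simp: admissible_line_def positive_params_def dest: in_set_takeD)
    moreover from that(2) \<open>A > 0\<close> have "1 - Re \<alpha> - A * Re s \<le> 0"
      using nonpos_Ints_Re_le_0[of "1 - \<alpha> - of_real A * s"] is_pole_Gamma_affine_iff[of "- A" "1 - \<alpha>" s]
      by simp
    ultimately have "A * Re s > A * \<gamma>" by linarith
    then show ?thesis using \<open>A > 0\<close> by (intro right_of_line) simp
  qed
  ultimately show ?thesis by (auto simp: separates_poles_def)
qed

lemma separates_polesD:
  assumes "separates_poles m n as bs g" "separates_poles m n as bs h"
    "positive_params as" "positive_params bs" "w \<in> fox_poles m n as bs"
  shows "w \<in> left_of_contour g \<inter> left_of_contour h \<or> w \<in> right_of_contour g \<inter> right_of_contour h"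
proof -
  consider \<beta> B where "(\<beta>, B) \<in> set (take m bs)" "\<beta> + of_real B * w \<in> \<int>\<^sub>\<le>\<^sub>0"
    | \<alpha> A where "(\<alpha>, A) \<in> set (take n as)" "1 - \<alpha> - of_real A * w \<in> \<int>\<^sub>\<le>\<^sub>0"
    using assms(5) unfolding fox_poles_def by blast
  then show ?thesis
  proof cases
    case 1
    then have "B \<noteq> 0" using assms(4) by (auto simp: positive_params_def dest: in_set_takeD)
    then have "is_pole (\<lambda>u. Gamma (\<beta> + of_real B * u)) w" using 1 by (simp add: is_pole_Gamma_affine_iff)
    then show ?thesis using 1 assms(1,2) unfolding separates_poles_def by blast
  next
    case 2
    then have "- A \<noteq> 0" using assms(3) by (auto simp: positive_params_def dest: in_set_takeD)
    from is_pole_Gamma_affine_iff[OF this, of "1 - \<alpha>" w]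
    have "is_pole (\<lambda>u. Gamma (1 - \<alpha> - of_real A * u)) w" using 2 by simp
    then show ?thesis using 2 assms(1,2) unfolding separates_poles_def by blast
  qed
qed

section \<open>Absolute convergence on vertical lines and the value of the H-function\<close>

lemma integrable_exp_neg_abs:
  assumes "d > 0"
  shows "integrable lborel (\<lambda>y::real. exp (- d * \<bar>y\<bar>))"
proof (rule Bochner_Integration.integrable_bound)
  have "set_integrable lborel (einterval (- \<infinity>) \<infinity>) (\<lambda>y::real. inverse (1 + y\<^sup>2))"
    using integrable_inverse_1_plus_square .
  then have "integrable lborel (\<lambda>y::real. inverse (1 + y\<^sup>2))"
    by (simp add: set_integrable_def)
  then show "integrable lborel (\<lambda>y::real. (1 + 2 / d\<^sup>2) * inverse (1 + y\<^sup>2))"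
    by simp
  show "AE y in lborel. norm (exp (- d * \<bar>y\<bar>)) \<le> norm ((1 + 2 / d\<^sup>2) * inverse (1 + y\<^sup>2))"
  proof (rule AE_I2)
    fix y :: real
    have "1 + d * \<bar>y\<bar> + (d * \<bar>y\<bar>)\<^sup>2 / 2 \<le> exp (d * \<bar>y\<bar>)"
      using assms by (intro exp_lower_Taylor_quadratic) auto
    moreover have "0 \<le> d * \<bar>y\<bar>" using assms by simp
    ultimately have "d\<^sup>2 * y\<^sup>2 \<le> 2 * exp (d * \<bar>y\<bar>)" "1 \<le> exp (d * \<bar>y\<bar>)"
      by (auto simp: power_mult_distrib)
    moreover from this(1) have "y\<^sup>2 \<le> 2 / d\<^sup>2 * exp (d * \<bar>y\<bar>)"
      using assms by (simp add: field_simps)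
    ultimately have "1 + y\<^sup>2 \<le> exp (d * \<bar>y\<bar>) + 2 / d\<^sup>2 * exp (d * \<bar>y\<bar>)"
      by linarith
    also have "\<dots> = (1 + 2 / d\<^sup>2) * exp (d * \<bar>y\<bar>)"
      by (simp add: distrib_right)
    finally have "1 + y\<^sup>2 \<le> (1 + 2 / d\<^sup>2) * exp (d * \<bar>y\<bar>)" .
    then have "exp (- d * \<bar>y\<bar>) \<le> (1 + 2 / d\<^sup>2) * inverse (1 + y\<^sup>2)"
      by (simp add: exp_minus field_simps add_pos_nonneg)
    then show "norm (exp (- d * \<bar>y\<bar>)) \<le> norm ((1 + 2 / d\<^sup>2) * inverse (1 + y\<^sup>2))"
      by simp
  qed
qed auto

lemma strip_decay_bound_line:
  assumes decay: "strip_decay F c" "c > 0" and cont: "continuous_on UNIV (\<lambda>y. F (Complex \<gamma> y))"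
  obtains K d where "d > 0" "K \<ge> 0" "\<And>y. norm (F (Complex \<gamma> y)) \<le> K * exp (- d * \<bar>y\<bar>)"
proof -
  define d where "d = c / 2"
  have d: "d > 0" "d < c" using decay by (auto simp: d_def)
  obtain C T where CT: "C \<ge> 0" "T \<ge> 0"
    "\<And>s. \<gamma> \<le> Re s \<Longrightarrow> Re s \<le> \<gamma> \<Longrightarrow> T \<le> \<bar>Im s\<bar> \<Longrightarrow> norm (F s) \<le> C * exp (- d * \<bar>Im s\<bar>)"
    using strip_decayE[OF decay(1) d(2)] by metis
  have "bounded ((\<lambda>y. F (Complex \<gamma> y)) ` {-T..T})"
    using cont by (intro compact_imp_bounded compact_continuous_image) (auto intro: continuous_on_subset)
  then obtain M where M: "M > 0" "\<And>y. y \<in> {-T..T} \<Longrightarrow> norm (F (Complex \<gamma> y)) \<le> M"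
    unfolding bounded_pos by blast
  show thesis
  \<comment> \<open>On \<open>[-T, T]\<close> the modulus is at most \<open>M\<close>, and
    \<open>exp (d * T)\<close> makes up for \<open>exp (- d * |y|)\<close> there; \<open>C\<close>
    serves the two ends.\<close>
  proof (rule that[OF d(1), of "C + M * exp (d * T)"])
    fix y :: real
    show "norm (F (Complex \<gamma> y)) \<le> (C + M * exp (d * T)) * exp (- d * \<bar>y\<bar>)"
    proof (cases "T \<le> \<bar>y\<bar>")
      case True
      then have "norm (F (Complex \<gamma> y)) \<le> C * exp (- d * \<bar>y\<bar>)" using CT(3)[of "Complex \<gamma> y"] by simp
      also have "\<dots> \<le> (C + M * exp (d * T)) * exp (- d * \<bar>y\<bar>)" using M by (intro mult_right_mono) auto
      finally show ?thesis .
    next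
      case False
      then have "norm (F (Complex \<gamma> y)) \<le> M * 1" by (simp, intro M(2)) auto
      also have "\<dots> \<le> M * (exp (d * T) * exp (- d * \<bar>y\<bar>))"
        using M(1) False d by (intro mult_left_mono) (auto simp: mult_exp_exp)
      also have "\<dots> \<le> (C + M * exp (d * T)) * exp (- d * \<bar>y\<bar>)" using CT(1) by (simp add: algebra_simps)
      finally show ?thesis .
    qed
  qed (use CT M in auto)
qed

lemma strip_decay_integrable_line:
  assumes decay: "strip_decay F c" "c > 0" and cont: "continuous_on UNIV (\<lambda>y. F (Complex \<gamma> y))"
  shows "integrable lborel (\<lambda>y. F (Complex \<gamma> y))"
proof -
  obtain K d where K: "d > 0" "K \<ge> 0" "\<And>y. norm (F (Complex \<gamma> y)) \<le> K * exp (- d * \<bar>y\<bar>)"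
    using strip_decay_bound_line[OF assms] by blast
  show ?thesis
  proof (rule Bochner_Integration.integrable_bound)
    show "integrable lborel (\<lambda>y::real. K * exp (- d * \<bar>y\<bar>))"
      using integrable_exp_neg_abs[OF K(1)] by simp
    show "(\<lambda>y. F (Complex \<gamma> y)) \<in> borel_measurable lborel"
      using borel_measurable_continuous_onI[OF cont] by simp
    show "AE y in lborel. norm (F (Complex \<gamma> y)) \<le> norm (K * exp (- d * \<bar>y\<bar>))"
      using K by (simp add: abs_mult)
  qed
qed

text \<open>For \<open>z > 0\<close> the modulus depends on \<open>Re s\<close> alone, so this
  factor is bounded in a strip and leaves the rate of the kernel unchanged.\<close>

lemma strip_decay_powr:
  assumes "z > 0"
  shows "strip_decay (\<lambda>s. complex_of_real z powr (- s)) 0"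
  unfolding strip_decay_def
proof (intro allI impI)
  fix a b d :: real assume d: "d < 0"
  define M where "M = exp ((\<bar>a\<bar> + \<bar>b\<bar>) * \<bar>ln z\<bar>)"
  have "norm (complex_of_real z powr (- s)) \<le> M * exp (- d * \<bar>Im s\<bar>)" if "a \<le> Re s" "Re s \<le> b" for s
  proof -
    have "\<bar>Re s * ln z\<bar> \<le> (\<bar>a\<bar> + \<bar>b\<bar>) * \<bar>ln z\<bar>"
      unfolding abs_mult using that by (intro mult_right_mono) auto
    then have "norm (complex_of_real z powr (- s)) \<le> M"
      using assms by (simp add: norm_powr_real_powr powr_def M_def abs_le_iff)
    also have "M * 1 \<le> M * exp (- d * \<bar>Im s\<bar>)"
      using d by (intro mult_left_mono) (auto simp: M_def intro: mult_nonpos_nonneg)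
    finally show ?thesis by simp
  qed
  then show "\<exists>C T. \<forall>s. a \<le> Re s \<and> Re s \<le> b \<and> T \<le> \<bar>Im s\<bar> \<longrightarrow>
      norm (complex_of_real z powr (- s)) \<le> C * exp (- d * \<bar>Im s\<bar>)"
    by blast
qed

context
  fixes m n :: nat and as bs :: "(complex \<times> real) list" and \<gamma> :: real
  assumes positive: "positive_params as" "positive_params bs"
    and chi: "fox_chi m n as bs > 0" and line: "admissible_line m n as bs \<gamma>"
begin

lemma strip_decay_fox_Xi_positive: "strip_decay (fox_Xi m n as bs) (pi / 2 * fox_chi m n as bs)"
  by (rule strip_decay_fox_Xi) (use positive in \<open>auto simp: positive_params_def\<close>)

lemma finite_fox_poles_positive: "finite {s \<in> fox_poles m n as bs. \<bar>Re s\<bar> \<le> X}"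
  by (rule finite_fox_poles_strip) (use positive in \<open>auto simp: positive_params_def\<close>)

lemma continuous_on_fox_Xi_line: "continuous_on UNIV (\<lambda>y. fox_Xi m n as bs (Complex \<gamma> y))"
proof -
  have "continuous_on (- fox_poles m n as bs) (fox_Xi m n as bs)"
    using holomorphic_on_fox_Xi by (rule holomorphic_on_imp_continuous_on)
  from this continuous_on_line show ?thesis
    by (rule continuous_on_compose2) (use admissible_line_disjoint_poles[OF line] in auto)
qed

lemma integrable_fox_Xi_line: "integrable lborel (\<lambda>y. fox_Xi m n as bs (Complex \<gamma> y))"
  using strip_decay_fox_Xi_positive _ continuous_on_fox_Xi_line
  by (rule strip_decay_integrable_line) (use chi in auto)

lemma bounded_fox_Xi_line:
  obtains M where "\<And>y. norm (fox_Xi m n as bs (Complex \<gamma> y)) \<le> M"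
proof -
  obtain K d where "d > 0" "K \<ge> 0" "\<And>y. norm (fox_Xi m n as bs (Complex \<gamma> y)) \<le> K * exp (- d * \<bar>y\<bar>)"
    using strip_decay_bound_line[OF strip_decay_fox_Xi_positive _ continuous_on_fox_Xi_line] chi
    by (metis mult_pos_pos pi_half_gt_zero)
  moreover from this have "K * exp (- d * \<bar>y\<bar>) \<le> K" for y
    by (intro mult_left_le) auto
  ultimately show thesis by (intro that[of K]) (meson order_trans)
qed

text \<open>The line is one admissible contour and every other one has the same integral, which
  settles the definite description. Along the line \<open>ds\<close> is \<open>\<i>\<close> times
  \<open>dy\<close>, which cancels the \<open>\<i>\<close> of the prefactor.\<close>

lemma fox_H_eq_line_integral:
  assumes z: "z > 0"
  shows "fox_H m n as bs z =
    1 / (2 * of_real pi) * (LBINT y. fox_Xi m n as bs (Complex \<gamma> y) * of_real z powr (- Complex \<gamma> y))"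
proof -
  define F where "F s = fox_Xi m n as bs s * complex_of_real z powr (- s)" for s
  have holo: "F holomorphic_on - fox_poles m n as bs"
    unfolding F_def using z by (intro holomorphic_intros holomorphic_on_fox_Xi) auto
  have decay: "strip_decay F (pi / 2 * fox_chi m n as bs + 0)"
    unfolding F_def using z by (intro strip_decay_mult strip_decay_fox_Xi_positive strip_decay_powr)
  have rate: "pi / 2 * fox_chi m n as bs + 0 > 0" using chi by simp
  have "continuous_on UNIV (\<lambda>y. F (Complex \<gamma> y))"
  proof -
    have "continuous_on (- fox_poles m n as bs) F"
      using holo by (rule holomorphic_on_imp_continuous_on)
    from this continuous_on_line show ?thesis
      by (rule continuous_on_compose2) (use admissible_line_disjoint_poles[OF line] in auto)
  qed
  then have "integrable lborel (\<lambda>y. F (Complex \<gamma> y))"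
    using strip_decay_integrable_line[OF decay rate] by blast
  then have "((\<lambda>y. F (Complex \<gamma> y)) has_integral (LBINT y. F (Complex \<gamma> y))) UNIV"
    by (rule has_integral_integral_lborel)
  then have I: "has_vertical_contour_integral F ((LBINT y. F (Complex \<gamma> y)) * \<i>) (Complex \<gamma>)"
    unfolding has_vertical_contour_integral_def vector_derivative_line by (rule has_integral_mult_left)
  have sep: "separates_poles m n as bs (Complex \<gamma>)"
    using line positive by (rule separates_poles_line)
  have uniq: "I = (LBINT y. F (Complex \<gamma> y)) * \<i>"
    if "vertical_contour \<gamma>' g" "separates_poles m n as bs g" "has_vertical_contour_integral F I g" for \<gamma>' g I
    using holo finite_fox_poles_positive decay rate that(1) vertical_contour_line
      separates_polesD[OF that(2) sep positive] that(3) I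
    by (rule vertical_contour_integral_unique)
  have "fox_H m n as bs z = 1 / (2 * of_real pi * \<i>) * ((LBINT y. F (Complex \<gamma> y)) * \<i>)"
    unfolding fox_H_def F_def[symmetric]
  proof (rule the_equality)
    show "\<exists>\<gamma>' g I. vertical_contour \<gamma>' g \<and> separates_poles m n as bs g \<and>
        has_vertical_contour_integral F I g \<and>
        1 / (2 * of_real pi * \<i>) * ((LBINT y. F (Complex \<gamma> y)) * \<i>) = 1 / (2 * of_real pi * \<i>) * I"
      using vertical_contour_line sep I by blast
  next
    fix w assume "\<exists>\<gamma>' g I. vertical_contour \<gamma>' g \<and> separates_poles m n as bs g \<and>
        has_vertical_contour_integral F I g \<and> w = 1 / (2 * of_real pi * \<i>) * I"
    then show "w = 1 / (2 * of_real pi * \<i>) * ((LBINT y. F (Complex \<gamma> y)) * \<i>)"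
      using uniq by blast
  qed
  then show ?thesis by (simp add: F_def)
qed

end

section \<open>Fourier inversion\<close>

text \<open>The sign of the phase and the missing factor \<open>1 / (2 * pi)\<close> are chosen to
  match \<open>exp x powr (- s)\<close> on a vertical line.\<close>

definition fourier :: "(real \<Rightarrow> complex) \<Rightarrow> real \<Rightarrow> complex" where
  "fourier \<phi> x = (LBINT v. \<phi> v * exp (- (\<i> * of_real (v * x))))"

lemma norm_exp_i [simp]: "norm (exp (\<i> * complex_of_real x)) = 1" "norm (exp (- (\<i> * complex_of_real x))) = 1"
  by (simp_all add: norm_exp_eq_Re)

text \<open>A unimodular kernel does not affect the absolute integrability of a product of functions
  of separate variables. This justifies the exchange of integrals both in the inversion formula and
  in the convolution.\<close>

lemma integrable_kernel_product:
  fixes f g :: "real \<Rightarrow> complex"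
  assumes f: "integrable lborel f" and g: "integrable lborel g"
    and k: "(\<lambda>(x, v). k x v) \<in> borel_measurable (lborel \<Otimes>\<^sub>M lborel)" "\<And>x v. norm (k x v) = 1"
  shows "integrable (lborel \<Otimes>\<^sub>M lborel) (\<lambda>(x, v). f x * (g v * k x v))"
proof (rule lborel_pair.Fubini_integrable)
  note [measurable] = borel_measurable_integrable[OF f] borel_measurable_integrable[OF g] k(1)
  show "(\<lambda>(x, v). f x * (g v * k x v)) \<in> borel_measurable (lborel \<Otimes>\<^sub>M lborel)"
    by measurable
  show "integrable lborel (\<lambda>x. LBINT v. norm (case (x, v) of (x, v) \<Rightarrow> f x * (g v * k x v)))"
    using f by (simp add: norm_mult k)
  have "integrable lborel (\<lambda>v. g v * k x v)" for x
  proof (rule Bochner_Integration.integrable_bound[OF g])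
    show "(\<lambda>v. g v * k x v) \<in> borel_measurable lborel" by measurable
  qed (simp add: norm_mult k)
  then show "AE x in lborel. integrable lborel (\<lambda>v. case (x, v) of (x, v) \<Rightarrow> f x * (g v * k x v))"
    by simp
qed

text \<open>This is the characteristic function of the standard normal distribution at
  \<open>t / \<sigma>\<close>, after rescaling the variable by \<open>\<sigma>\<close>.\<close>

lemma gaussian_fourier:
  assumes "\<sigma> > 0"
  shows "(LBINT x. complex_of_real (std_normal_density (\<sigma> * x)) * exp (\<i> * of_real (t * x))) =
    of_real (exp (- (t / \<sigma>)\<^sup>2 / 2) / \<sigma>)"
proof -
  have "(LBINT x. std_normal_density x *\<^sub>R exp (\<i> * of_real (t / \<sigma> * x))) = char std_normal_distribution (t / \<sigma>)"
    unfolding char_def by (subst integral_density) (auto simp: normal_density_nonneg)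
  also have "\<dots> = of_real (exp (- (t / \<sigma>)\<^sup>2 / 2))"
    by (simp add: char_std_normal_distribution)
  finally have *: "(LBINT x. std_normal_density x *\<^sub>R exp (\<i> * of_real (t / \<sigma> * x))) =
    of_real (exp (- (t / \<sigma>)\<^sup>2 / 2))" .
  have "(LBINT x. complex_of_real (std_normal_density (\<sigma> * x)) * exp (\<i> * of_real (t * x)))
     = \<bar>1 / \<sigma>\<bar> *\<^sub>R (LBINT x. complex_of_real (std_normal_density (\<sigma> * (0 + 1 / \<sigma> * x))) * exp (\<i> * of_real (t * (0 + 1 / \<sigma> * x))))"
    using assms by (intro lborel_integral_real_affine) auto
  also have "(\<lambda>x. complex_of_real (std_normal_density (\<sigma> * (0 + 1 / \<sigma> * x))) * exp (\<i> * of_real (t * (0 + 1 / \<sigma> * x))))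
      = (\<lambda>x. std_normal_density x *\<^sub>R exp (\<i> * of_real (t / \<sigma> * x)))"
    using assms by (auto simp: scaleR_conv_of_real)
  finally show ?thesis
    unfolding * using assms by (simp add: scaleR_conv_of_real)
qed

text \<open>Gaussian summation: the integrand is damped by the normal density at
  \<open>\<sigma> n * x\<close>, with \<open>\<sigma> n\<close> tending to 0. By Fubini the damped
  integral is, up to a constant, an average of \<open>\<phi>\<close> over a normal distribution that
  concentrates at \<open>y\<close>. Dominated convergence applies on both sides, by integrability of
  \<open>fourier \<phi>\<close> on the one and boundedness of \<open>\<phi>\<close> on the
  other.\<close>

lemma fourier_inversion:
  assumes cont: "continuous_on UNIV \<phi>" and int: "integrable lborel \<phi>"
    and bound: "\<And>y. norm (\<phi> y) \<le> M" and int': "integrable lborel (fourier \<phi>)"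
  shows "(LBINT x. fourier \<phi> x * exp (\<i> * of_real (y * x))) = 2 * of_real pi * \<phi> y"
proof -
  note [measurable] = borel_measurable_integrable[OF int] borel_measurable_integrable[OF int']
  define D where "D = (std_normal_density :: real \<Rightarrow> real)"
  have D [measurable]: "D \<in> borel_measurable borel" and intD: "integrable lborel D"
    and D1: "(LBINT x. D x) = 1"
    by (simp_all add: D_def)
  have D_nonneg: "D x \<ge> 0" and D_le: "D x \<le> 1 / sqrt (2 * pi)" and contD: "isCont D x" for x
    unfolding D_def normal_density_def[abs_def]
    by (auto intro!: continuous_intros divide_right_mono)
  define \<sigma> where "\<sigma> n = 1 / real (Suc n)" for n
  have \<sigma>: "\<sigma> n > 0" for n by (simp add: \<sigma>_def)
  have \<sigma>_lim: "\<sigma> \<longlonglongrightarrow> 0" unfolding \<sigma>_def by (rule LIMSEQ_Suc[OF lim_1_over_n])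
  have eq: "(LBINT x. fourier \<phi> x * exp (\<i> * of_real (y * x)) * of_real (D (\<sigma> n * x))) =
      of_real (sqrt (2 * pi)) * (LBINT w. \<phi> (y + \<sigma> n * w) * of_real (D w))" for n
  proof -
    have "integrable lborel (\<lambda>x. D (0 + \<sigma> n * x))"
      using intD \<sigma>[of n] by (intro lborel_integrable_real_affine) auto
    then have "integrable lborel (\<lambda>x. complex_of_real (D (\<sigma> n * x)))" by simp
    then have prod: "integrable (lborel \<Otimes>\<^sub>M lborel)
        (\<lambda>(x, v). of_real (D (\<sigma> n * x)) * (\<phi> v * exp (\<i> * of_real ((y - v) * x))))"
      using int by (rule integrable_kernel_product) auto
    have "(LBINT x. fourier \<phi> x * exp (\<i> * of_real (y * x)) * of_real (D (\<sigma> n * x))) =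
      (LBINT x. LBINT v. of_real (D (\<sigma> n * x)) * (\<phi> v * exp (\<i> * of_real ((y - v) * x))))"
    proof (rule Bochner_Integration.integral_cong[OF refl])
      fix x :: real
      have "fourier \<phi> x * exp (\<i> * of_real (y * x)) * of_real (D (\<sigma> n * x)) =
        (LBINT v. \<phi> v * exp (- (\<i> * of_real (v * x)))) * (exp (\<i> * of_real (y * x)) * of_real (D (\<sigma> n * x)))"
        by (simp add: fourier_def mult_ac)
      also have "\<dots> = (LBINT v. \<phi> v * exp (- (\<i> * of_real (v * x))) * (exp (\<i> * of_real (y * x)) * of_real (D (\<sigma> n * x))))"
        by (rule integral_mult_left_zero[symmetric])
      also have "\<dots> = (LBINT v. of_real (D (\<sigma> n * x)) * (\<phi> v * exp (\<i> * of_real ((y - v) * x))))"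
      proof (rule Bochner_Integration.integral_cong[OF refl])
        fix v :: real
        have "exp (\<i> * of_real ((y - v) * x)) = exp (- (\<i> * of_real (v * x))) * exp (\<i> * of_real (y * x))"
          by (simp add: mult_exp_exp algebra_simps)
        then show "\<phi> v * exp (- (\<i> * of_real (v * x))) * (exp (\<i> * of_real (y * x)) * of_real (D (\<sigma> n * x))) =
          of_real (D (\<sigma> n * x)) * (\<phi> v * exp (\<i> * of_real ((y - v) * x)))"
          by (simp add: mult_ac)
      qed
      finally show "fourier \<phi> x * exp (\<i> * of_real (y * x)) * of_real (D (\<sigma> n * x)) =
         (LBINT v. of_real (D (\<sigma> n * x)) * (\<phi> v * exp (\<i> * of_real ((y - v) * x))))" .
    qed
    also have "\<dots> = (LBINT v. LBINT x. of_real (D (\<sigma> n * x)) * (\<phi> v * exp (\<i> * of_real ((y - v) * x))))"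
      using lborel_pair.Fubini_integral[OF prod] by simp
    also have "\<dots> = (LBINT v. \<phi> v * of_real (exp (- ((y - v) / \<sigma> n)\<^sup>2 / 2) / \<sigma> n))"
    proof (rule Bochner_Integration.integral_cong[OF refl])
      fix v :: real
      have "(LBINT x. of_real (D (\<sigma> n * x)) * (\<phi> v * exp (\<i> * of_real ((y - v) * x)))) =
        (LBINT x. \<phi> v * (of_real (D (\<sigma> n * x)) * exp (\<i> * of_real ((y - v) * x))))"
        by (simp add: mult_ac)
      also have "\<dots> = \<phi> v * (LBINT x. of_real (D (\<sigma> n * x)) * exp (\<i> * of_real ((y - v) * x)))"
        by (rule integral_mult_right_zero)
      finally show "(LBINT x. of_real (D (\<sigma> n * x)) * (\<phi> v * exp (\<i> * of_real ((y - v) * x)))) =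
        \<phi> v * of_real (exp (- ((y - v) / \<sigma> n)\<^sup>2 / 2) / \<sigma> n)"
        unfolding D_def gaussian_fourier[OF \<sigma>] .
    qed
    \<comment> \<open>The substitution \<open>v = y + \<sigma> n * w\<close> turns the narrowing
      Gaussian into a fixed one, so that only the argument of \<open>\<phi>\<close> depends on
      \<open>n\<close>.\<close>
    also have "\<dots> = \<bar>\<sigma> n\<bar> *\<^sub>R (LBINT w. \<phi> (y + \<sigma> n * w) * of_real (exp (- ((y - (y + \<sigma> n * w)) / \<sigma> n)\<^sup>2 / 2) / \<sigma> n))"
      using \<sigma>[of n] by (intro lborel_integral_real_affine) auto
    also have "\<dots> = (LBINT w. \<bar>\<sigma> n\<bar> *\<^sub>R (\<phi> (y + \<sigma> n * w) * of_real (exp (- ((y - (y + \<sigma> n * w)) / \<sigma> n)\<^sup>2 / 2) / \<sigma> n)))"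
      by (rule integral_scaleR_right[symmetric])
    also have "\<dots> = (LBINT w. of_real (sqrt (2 * pi)) * (\<phi> (y + \<sigma> n * w) * of_real (D w)))"
      using \<sigma>[of n]
      by (intro Bochner_Integration.integral_cong refl) (simp add: D_def normal_density_def scaleR_conv_of_real)
    also have "\<dots> = of_real (sqrt (2 * pi)) * (LBINT w. \<phi> (y + \<sigma> n * w) * of_real (D w))"
      by (rule integral_mult_right_zero)
    finally show ?thesis .
  qed
  have "(\<lambda>n. LBINT x. fourier \<phi> x * exp (\<i> * of_real (y * x)) * of_real (D (\<sigma> n * x)))
      \<longlonglongrightarrow> (LBINT x. fourier \<phi> x * exp (\<i> * of_real (y * x)) * of_real (D 0))"
  proof (rule integral_dominated_convergence)
    show "integrable lborel (\<lambda>x. norm (fourier \<phi> x) * (1 / sqrt (2 * pi)))"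
      using int' by (intro integrable_mult_left integrable_norm)
    show "AE x in lborel. (\<lambda>n. fourier \<phi> x * exp (\<i> * of_real (y * x)) * of_real (D (\<sigma> n * x)))
        \<longlonglongrightarrow> fourier \<phi> x * exp (\<i> * of_real (y * x)) * of_real (D 0)"
    proof (rule AE_I2)
      fix x :: real
      have "(\<lambda>n. \<sigma> n * x) \<longlonglongrightarrow> 0 * x" by (intro tendsto_intros \<sigma>_lim)
      then have "(\<lambda>n. D (\<sigma> n * x)) \<longlonglongrightarrow> D 0" using isCont_tendsto_compose[OF contD] by fastforce
      then show "(\<lambda>n. fourier \<phi> x * exp (\<i> * of_real (y * x)) * of_real (D (\<sigma> n * x)))
        \<longlonglongrightarrow> fourier \<phi> x * exp (\<i> * of_real (y * x)) * of_real (D 0)"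
        by (intro tendsto_intros)
    qed
    show "AE x in lborel. norm (fourier \<phi> x * exp (\<i> * of_real (y * x)) * of_real (D (\<sigma> n * x)))
        \<le> norm (fourier \<phi> x) * (1 / sqrt (2 * pi))" for n
      using D_nonneg D_le by (intro AE_I2) (simp only: norm_mult norm_exp_i norm_of_real abs_of_nonneg mult_1_right mult_left_mono norm_ge_zero)
  qed simp_all
  moreover have "(\<lambda>n. of_real (sqrt (2 * pi)) * (LBINT w. \<phi> (y + \<sigma> n * w) * of_real (D w)))
      \<longlonglongrightarrow> of_real (sqrt (2 * pi)) * (LBINT w. \<phi> y * of_real (D w))"
  proof (intro tendsto_mult tendsto_const integral_dominated_convergence)
    show "integrable lborel (\<lambda>w. M * D w)" using intD by simp
    show "AE w in lborel. (\<lambda>n. \<phi> (y + \<sigma> n * w) * of_real (D w)) \<longlonglongrightarrow> \<phi> y * of_real (D w)"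
    proof (rule AE_I2)
      fix w :: real
      have "(\<lambda>n. y + \<sigma> n * w) \<longlonglongrightarrow> y + 0 * w" by (intro tendsto_intros \<sigma>_lim)
      moreover have "isCont \<phi> y" using cont by (simp add: continuous_on_eq_continuous_at)
      ultimately have "(\<lambda>n. \<phi> (y + \<sigma> n * w)) \<longlonglongrightarrow> \<phi> y" using isCont_tendsto_compose by fastforce
      then show "(\<lambda>n. \<phi> (y + \<sigma> n * w) * of_real (D w)) \<longlonglongrightarrow> \<phi> y * of_real (D w)"
        by (intro tendsto_intros)
    qed
    show "AE w in lborel. norm (\<phi> (y + \<sigma> n * w) * of_real (D w)) \<le> M * D w" for n
      using D_nonneg bound by (intro AE_I2) (simp add: norm_mult mult_right_mono)
  qed simp_all
  ultimately have "(LBINT x. fourier \<phi> x * exp (\<i> * of_real (y * x)) * of_real (D 0)) =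
      of_real (sqrt (2 * pi)) * (LBINT w. \<phi> y * of_real (D w))"
    unfolding eq by (rule LIMSEQ_unique)
  also have "(LBINT w. \<phi> y * of_real (D w)) = \<phi> y"
    using D1 by (simp add: integral_complex_of_real)
  also have "(LBINT x. fourier \<phi> x * exp (\<i> * of_real (y * x)) * of_real (D 0)) =
     (LBINT x. fourier \<phi> x * exp (\<i> * of_real (y * x))) * of_real (D 0)"
    by (rule integral_mult_left_zero)
  finally have *: "(LBINT x. fourier \<phi> x * exp (\<i> * of_real (y * x))) * of_real (D 0) = of_real (sqrt (2 * pi)) * \<phi> y" .
  \<comment> \<open>The limit of the damping factor is \<open>1 / sqrt (2 * pi)\<close>; moving it
    across supplies the second root in \<open>2 * pi\<close>.\<close>
  have "D 0 * sqrt (2 * pi) = 1" by (simp add: D_def normal_density_def)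
  then have "(LBINT x. fourier \<phi> x * exp (\<i> * of_real (y * x))) =
      (LBINT x. fourier \<phi> x * exp (\<i> * of_real (y * x))) * of_real (D 0) * of_real (sqrt (2 * pi))"
    unfolding mult.assoc of_real_mult[symmetric] by simp
  also have "\<dots> = of_real (sqrt (2 * pi) * sqrt (2 * pi)) * \<phi> y"
    unfolding * by (simp only: of_real_mult mult_ac)
  finally show ?thesis by simp
qed

lemma fourier_product_pos:
  assumes int1: "integrable lborel \<phi>1" and pos1: "\<And>x. fourier \<phi>1 x > 0"
    and cont2: "continuous_on UNIV \<phi>2" and int2: "integrable lborel \<phi>2" "integrable lborel (fourier \<phi>2)"
    and bound2: "\<And>y. norm (\<phi>2 y) \<le> M" and pos2: "\<And>x. fourier \<phi>2 x > 0"
  shows "fourier (\<lambda>y. \<phi>1 y * \<phi>2 (- (\<Lambda> * y))) x > 0"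
proof -
  define h where "h u = fourier \<phi>2 u * fourier \<phi>1 (x + \<Lambda> * u)" for u
  have prod: "integrable (lborel \<Otimes>\<^sub>M lborel)
      (\<lambda>(u, y). fourier \<phi>2 u * (\<phi>1 y * exp (- (\<i> * of_real (y * (x + \<Lambda> * u))))))"
    using int2(2) int1 by (rule integrable_kernel_product) auto
  have h: "h u = (LBINT y. fourier \<phi>2 u * (\<phi>1 y * exp (- (\<i> * of_real (y * (x + \<Lambda> * u))))))" for u
    unfolding h_def fourier_def[of \<phi>1] by (rule integral_mult_right_zero[symmetric])
  have h_pos: "h u > 0" for u
    using pos2[of u] pos1[of "x + \<Lambda> * u"] by (simp add: h_def less_complex_def)
  then have Re_h: "Re (h u) > 0" for u
    by (simp add: less_complex_def)
  have int_h: "integrable lborel h"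
    using lborel_pair.integrable_fst[OF prod] by (simp add: h[abs_def])
  have "2 * of_real pi * fourier (\<lambda>y. \<phi>1 y * \<phi>2 (- (\<Lambda> * y))) x =
      (LBINT y. 2 * of_real pi * (\<phi>1 y * \<phi>2 (- (\<Lambda> * y)) * exp (- (\<i> * of_real (y * x)))))"
    unfolding fourier_def by (rule integral_mult_right_zero[symmetric])
  also have "\<dots> = (LBINT y. LBINT u. fourier \<phi>2 u * (\<phi>1 y * exp (- (\<i> * of_real (y * (x + \<Lambda> * u))))))"
  proof (rule Bochner_Integration.integral_cong[OF refl])
    fix y :: real
    have "2 * of_real pi * (\<phi>1 y * \<phi>2 (- (\<Lambda> * y)) * exp (- (\<i> * of_real (y * x)))) =
      (2 * of_real pi * \<phi>2 (- (\<Lambda> * y))) * (\<phi>1 y * exp (- (\<i> * of_real (y * x))))"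
      by (simp add: mult_ac)
    \<comment> \<open>The phase from inversion at \<open>- (\<Lambda> * y)\<close> merges with the
      one at \<open>x\<close> into the phase at \<open>x + \<Lambda> * u\<close>, so that
      integrating over \<open>y\<close> first will give
      \<open>fourier \<phi>1 (x + \<Lambda> * u)\<close>.\<close>
    also have "2 * of_real pi * \<phi>2 (- (\<Lambda> * y)) = (LBINT u. fourier \<phi>2 u * exp (\<i> * of_real (- (\<Lambda> * y) * u)))"
      using fourier_inversion[OF cont2 int2(1) bound2 int2(2), of "- (\<Lambda> * y)"] by (rule sym)
    also have "\<dots> * (\<phi>1 y * exp (- (\<i> * of_real (y * x)))) =
      (LBINT u. fourier \<phi>2 u * exp (\<i> * of_real (- (\<Lambda> * y) * u)) * (\<phi>1 y * exp (- (\<i> * of_real (y * x)))))"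
      by (rule integral_mult_left_zero[symmetric])
    also have "\<dots> = (LBINT u. fourier \<phi>2 u * (\<phi>1 y * exp (- (\<i> * of_real (y * (x + \<Lambda> * u))))))"
    proof (rule Bochner_Integration.integral_cong[OF refl])
      fix u :: real
      have "exp (- (\<i> * of_real (y * (x + \<Lambda> * u)))) = exp (\<i> * of_real (- (\<Lambda> * y) * u)) * exp (- (\<i> * of_real (y * x)))"
        by (simp add: mult_exp_exp algebra_simps)
      then show "fourier \<phi>2 u * exp (\<i> * of_real (- (\<Lambda> * y) * u)) * (\<phi>1 y * exp (- (\<i> * of_real (y * x)))) =
        fourier \<phi>2 u * (\<phi>1 y * exp (- (\<i> * of_real (y * (x + \<Lambda> * u)))))"
        by (simp add: mult_ac)
    qed
    finally show "2 * of_real pi * (\<phi>1 y * \<phi>2 (- (\<Lambda> * y)) * exp (- (\<i> * of_real (y * x)))) =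
      (LBINT u. fourier \<phi>2 u * (\<phi>1 y * exp (- (\<i> * of_real (y * (x + \<Lambda> * u))))))" .
  qed
  also have "\<dots> = (LBINT u. h u)"
    using lborel_pair.Fubini_integral[OF prod] by (simp add: h)
  \<comment> \<open>A value that is positive in the complex order is real.\<close>
  also have "h = (\<lambda>u. of_real (Re (h u)))"
    using h_pos by (auto simp: less_complex_def complex_eq_iff)
  also have "(LBINT u. complex_of_real (Re (h u))) = of_real (LBINT u. Re (h u))"
    by (rule integral_complex_of_real)
  finally have eq: "2 * of_real pi * fourier (\<lambda>y. \<phi>1 y * \<phi>2 (- (\<Lambda> * y))) x = of_real (LBINT u. Re (h u))" .
  \<comment> \<open>A nonnegative function with integral 0 vanishes almost everywhere, but this one
    vanishes nowhere.\<close>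
  have "(LBINT u. Re (h u)) \<noteq> 0"
  proof
    assume "(LBINT u. Re (h u)) = 0"
    then have "AE u in lborel. Re (h u) = 0"
      using int_h Re_h by (subst (asm) integral_nonneg_eq_0_iff_AE) (auto intro: less_imp_le)
    then have "AE u in (lborel :: real measure). False"
      by (rule eventually_mono) (metis Re_h less_irrefl)
    then show False by (simp add: eventually_False ae_filter_eq_bot_iff)
  qed
  moreover have "(LBINT u. Re (h u)) \<ge> 0"
    using Re_h by (intro integral_nonneg_AE) (auto intro: less_imp_le)
  ultimately have "(LBINT u. Re (h u)) > 0" by simp
  then have "fourier (\<lambda>y. \<phi>1 y * \<phi>2 (- (\<Lambda> * y))) x = of_real ((LBINT u. Re (h u)) / (2 * pi))"
    "(LBINT u. Re (h u)) / (2 * pi) > 0"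
    using eq by (auto simp: field_simps)
  then show ?thesis by (simp add: less_complex_def)
qed

section \<open>Positivity\<close>

context
  fixes m n :: nat and as bs :: "(complex \<times> real) list" and \<gamma> :: real
  assumes positive: "positive_params as" "positive_params bs"
    and chi: "fox_chi m n as bs > 0" and line: "admissible_line m n as bs \<gamma>"
begin

lemma fox_H_exp_eq_fourier:
  "fox_H m n as bs (exp x) =
     of_real (exp (- \<gamma> * x) / (2 * pi)) * fourier (\<lambda>y. fox_Xi m n as bs (Complex \<gamma> y)) x"
proof -
  have "complex_of_real (exp x) powr (- Complex \<gamma> y) = of_real (exp (- \<gamma> * x)) * exp (- (\<i> * of_real (y * x)))" for y
  proof -
    have "complex_of_real (exp x) powr (- Complex \<gamma> y) = exp (- Complex \<gamma> y * of_real x)"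
      unfolding powr_def by (simp del: of_real_exp add: Ln_of_real)
    also have "- Complex \<gamma> y * of_real x = of_real (- \<gamma> * x) + - (\<i> * of_real (y * x))"
      by (simp add: complex_eq_iff)
    also have "exp \<dots> = of_real (exp (- \<gamma> * x)) * exp (- (\<i> * of_real (y * x)))"
      unfolding exp_add exp_of_real ..
    finally show ?thesis .
  qed
  then have "(LBINT y. fox_Xi m n as bs (Complex \<gamma> y) * of_real (exp x) powr (- Complex \<gamma> y)) =
      (LBINT y. of_real (exp (- \<gamma> * x)) * (fox_Xi m n as bs (Complex \<gamma> y) * exp (- (\<i> * of_real (y * x)))))"
    by (simp only: mult_ac)
  also have "\<dots> = of_real (exp (- \<gamma> * x)) * fourier (\<lambda>y. fox_Xi m n as bs (Complex \<gamma> y)) x"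
    unfolding fourier_def by (rule integral_mult_right_zero)
  finally show ?thesis
    unfolding fox_H_eq_line_integral[OF positive chi line, of "exp x", OF exp_gt_zero] by simp
qed

lemma fox_H_exp_pos_iff:
  "fox_H m n as bs (exp x) > 0 \<longleftrightarrow> fourier (\<lambda>y. fox_Xi m n as bs (Complex \<gamma> y)) x > 0"
  unfolding fox_H_exp_eq_fourier by (simp add: less_complex_def zero_less_divide_iff zero_less_mult_iff)

text \<open>The transform is bounded by the L1 norm of the kernel on the line, so the choice of the
  line decides the exponential weight.\<close>

lemma norm_fox_H_exp_le:
  obtains K where "\<And>x. norm (fox_H m n as bs (exp x)) \<le> K * exp (- \<gamma> * x)"
proof (rule that)
  let ?\<phi> = "\<lambda>y. fox_Xi m n as bs (Complex \<gamma> y)"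
  fix x
  have "norm (fourier ?\<phi> x) \<le> (LBINT y. norm (?\<phi> y * exp (- (\<i> * of_real (y * x)))))"
    unfolding fourier_def by (rule integral_norm_bound)
  also have "\<dots> = (LBINT y. norm (?\<phi> y))"
    by (simp only: norm_mult norm_exp_i mult_1_right)
  finally have "exp (- \<gamma> * x) / (2 * pi) * norm (fourier ?\<phi> x) \<le> exp (- \<gamma> * x) / (2 * pi) * (LBINT y. norm (?\<phi> y))"
    by (intro mult_left_mono) auto
  then show "norm (fox_H m n as bs (exp x)) \<le> (LBINT y. norm (?\<phi> y)) / (2 * pi) * exp (- \<gamma> * x)"
    unfolding fox_H_exp_eq_fourier norm_mult norm_of_real by (simp add: mult_ac)
qed

text \<open>Admissibility consists of finitely many strict inequalities that are continuous in the
  abscissa.\<close>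

lemma admissible_line_perturb:
  obtains \<epsilon> where "\<epsilon> > 0" "admissible_line m n as bs (\<gamma> + \<epsilon>)" "admissible_line m n as bs (\<gamma> - \<epsilon>)"
proof -
  have pos: "\<forall>\<^sub>F e in at_right 0. c + k * (\<gamma> + e) > 0 \<and> c + k * (\<gamma> - e) > 0" if "c + k * \<gamma> > 0" for c k :: real
  proof -
    have "((\<lambda>e. c + k * (\<gamma> + e)) \<longlongrightarrow> c + k * (\<gamma> + 0)) (at_right 0)"
      "((\<lambda>e. c + k * (\<gamma> - e)) \<longlongrightarrow> c + k * (\<gamma> - 0)) (at_right 0)"
      by (intro tendsto_intros)+
    from order_tendstoD(1)[OF this(1), of 0] order_tendstoD(1)[OF this(2), of 0] that
    show ?thesis by (intro eventually_conj) auto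
  qed
  have "\<forall>\<^sub>F e in at_right 0. \<forall>x\<in>set (take m bs). Re (fst x) + snd x * (\<gamma> + e) > 0 \<and> Re (fst x) + snd x * (\<gamma> - e) > 0"
    using line by (intro eventually_ball_finite ballI pos) (auto simp: admissible_line_def)
  moreover have "\<forall>\<^sub>F e in at_right 0. \<forall>x\<in>set (take n as). 1 - Re (fst x) + - snd x * (\<gamma> + e) > 0 \<and> 1 - Re (fst x) + - snd x * (\<gamma> - e) > 0"
    using line by (intro eventually_ball_finite ballI pos) (auto simp: admissible_line_def)
  moreover have "\<forall>\<^sub>F e in at_right (0::real). e > 0"
    by (rule eventually_at_right_less)
  ultimately have "\<forall>\<^sub>F e in at_right 0. e > 0 \<and> admissible_line m n as bs (\<gamma> + e) \<and> admissible_line m n as bs (\<gamma> - e)"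
    by eventually_elim (auto simp: admissible_line_def)
  then show thesis
    using that eventually_happens'[OF trivial_limit_at_right_real] by blast
qed

end

text \<open>
  Moving the line of integration by \<open>\<plusminus>\<epsilon>\<close> gives exponential decay at both ends.
\<close>

lemma integrable_fourier_fox_Xi:
  assumes positive: "positive_params as" "positive_params bs"
    and chi: "fox_chi m n as bs > 0" and line: "admissible_line m n as bs \<gamma>"
  shows "integrable lborel (fourier (\<lambda>y. fox_Xi m n as bs (Complex \<gamma> y)))"
proof -
  let ?h = "fourier (\<lambda>y. fox_Xi m n as bs (Complex \<gamma> y))"
  note [measurable] = borel_measurable_integrable[OF integrable_fox_Xi_line[OF assms]]
  obtain \<epsilon> where \<epsilon>: "\<epsilon> > 0" "admissible_line m n as bs (\<gamma> + \<epsilon>)" "admissible_line m n as bs (\<gamma> - \<epsilon>)"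
    using admissible_line_perturb[OF assms] by blast
  \<comment> \<open>Relative to the weight \<open>exp (- \<gamma> * x)\<close>, the line at
    \<open>\<gamma> + \<epsilon>\<close> gains \<open>exp (- \<epsilon> * x)\<close> for
    \<open>x \<ge> 0\<close>, and the line at \<open>\<gamma> - \<epsilon>\<close> gains
    \<open>exp (\<epsilon> * x)\<close> for \<open>x < 0\<close>.\<close>
  obtain K1 where K1: "\<And>x. norm (fox_H m n as bs (exp x)) \<le> K1 * exp (- (\<gamma> + \<epsilon>) * x)"
    using norm_fox_H_exp_le[OF positive chi \<epsilon>(2)] by blast
  obtain K2 where K2: "\<And>x. norm (fox_H m n as bs (exp x)) \<le> K2 * exp (- (\<gamma> - \<epsilon>) * x)"
    using norm_fox_H_exp_le[OF positive chi \<epsilon>(3)] by blast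
  define K where "K = 2 * pi * max K1 K2"
  show ?thesis
  proof (rule Bochner_Integration.integrable_bound)
    show "integrable lborel (\<lambda>x::real. K * exp (- \<epsilon> * \<bar>x\<bar>))"
      using integrable_exp_neg_abs[OF \<epsilon>(1)] by simp
    show "?h \<in> borel_measurable lborel"
      unfolding fourier_def by measurable
    show "AE x in lborel. norm (?h x) \<le> norm (K * exp (- \<epsilon> * \<bar>x\<bar>))"
    proof (rule AE_I2)
      fix x :: real
      have "norm (fox_H m n as bs (exp x)) \<le> max K1 K2 * exp (- \<gamma> * x - \<epsilon> * \<bar>x\<bar>)"
      proof (cases "x \<ge> 0")
        case True
        have "- (\<gamma> + \<epsilon>) * x = - \<gamma> * x - \<epsilon> * \<bar>x\<bar>" using True by (simp add: algebra_simps)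
        then have "K1 * exp (- (\<gamma> + \<epsilon>) * x) \<le> max K1 K2 * exp (- \<gamma> * x - \<epsilon> * \<bar>x\<bar>)"
          by (metis exp_ge_zero max.cobounded1 mult_right_mono)
        with K1[of x] show ?thesis by (rule order_trans)
      next
        case False
        have "- (\<gamma> - \<epsilon>) * x = - \<gamma> * x - \<epsilon> * \<bar>x\<bar>" using False by (simp add: algebra_simps)
        then have "K2 * exp (- (\<gamma> - \<epsilon>) * x) \<le> max K1 K2 * exp (- \<gamma> * x - \<epsilon> * \<bar>x\<bar>)"
          by (metis exp_ge_zero max.cobounded2 mult_right_mono)
        with K2[of x] show ?thesis by (rule order_trans)
      qed
      then have "exp (- \<gamma> * x) / (2 * pi) * norm (?h x) \<le> max K1 K2 * exp (- \<gamma> * x - \<epsilon> * \<bar>x\<bar>)"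
        unfolding fox_H_exp_eq_fourier[OF assms] norm_mult norm_of_real by simp
      also have "exp (- \<gamma> * x - \<epsilon> * \<bar>x\<bar>) = exp (- \<gamma> * x) * exp (- \<epsilon> * \<bar>x\<bar>)"
        by (simp add: mult_exp_exp)
      finally have "exp (- \<gamma> * x) * norm (?h x) \<le> exp (- \<gamma> * x) * (K * exp (- \<epsilon> * \<bar>x\<bar>))"
        by (simp add: K_def field_simps)
      then have "norm (?h x) \<le> K * exp (- \<epsilon> * \<bar>x\<bar>)" by simp
      then show "norm (?h x) \<le> norm (K * exp (- \<epsilon> * \<bar>x\<bar>))"
        by (simp add: abs_le_iff)
    qed
  qed
qed

section \<open>Compatibility of parameters and the choice of a common line\<close>

text \<open>Poles of the two families cannot coincide on opposite sides of a line: the real part of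
  \<open>A * (l + \<beta>)\<close> is greater than \<open>- A * B * \<gamma>\<close>, that of
  \<open>B * (\<alpha> - l' - 1)\<close> is smaller.\<close>

lemma fox_H_params_of_admissible_line:
  assumes "positive_params as" "positive_params bs" "admissible_line m n as bs \<gamma>"
    "n \<le> length as" "m \<le> length bs"
  shows "fox_H_params m n as bs"
proof -
  have "of_real A * (of_nat l + \<beta>) \<noteq> of_real B * (\<alpha> - of_nat l' - 1)"
    if \<alpha>: "(\<alpha>, A) \<in> set (take n as)" and \<beta>: "(\<beta>, B) \<in> set (take m bs)" for \<alpha> \<beta> A B and l l' :: nat
  proof
    assume "of_real A * (of_nat l + \<beta>) = of_real B * (\<alpha> - of_nat l' - 1)"
    then have "Re (of_real A * (of_nat l + \<beta>)) = Re (of_real B * (\<alpha> - of_nat l' - 1))" by simp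
    then have eq: "A * (real l + Re \<beta>) = B * (Re \<alpha> - real l' - 1)" by simp
    have pos: "A > 0" "B > 0" using \<alpha> \<beta> assms by (auto simp: positive_params_def dest: in_set_takeD)
    have "0 < Re \<beta> + B * \<gamma>" "0 < 1 - Re \<alpha> - A * \<gamma>" using \<alpha> \<beta> assms by (auto simp: admissible_line_def)
    then have "0 < A * (real l + Re \<beta> + B * \<gamma>)" "0 < B * (real l' + 1 - Re \<alpha> - A * \<gamma>)"
      using pos by auto
    then show False using eq by (simp add: algebra_simps)
  qed
  then show ?thesis
    using assms by (auto simp: fox_H_params_def positive_params_def)
qed

text \<open>Either side may be empty, which corresponds to minima equal to infinity, so
  \<open>Max\<close> and \<open>Min\<close> alone do not suffice.\<close>

lemma exists_between_finite_sets:
  fixes L U :: "real set"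
  assumes "finite L" "finite U" "\<And>l u. l \<in> L \<Longrightarrow> u \<in> U \<Longrightarrow> l < u"
  obtains x where "\<And>l. l \<in> L \<Longrightarrow> l < x" "\<And>u. u \<in> U \<Longrightarrow> x < u"
proof (cases "L = {} \<or> U = {}")
  case True
  then show thesis
  proof
    assume "L = {}"
    show thesis
    \<comment> \<open>Inserting 0 keeps the minimum meaningful if \<open>U\<close> is empty
      too.\<close>
    proof (rule that[of "Min (insert 0 U) - 1"])
      fix u assume "u \<in> U"
      then have "Min (insert 0 U) \<le> u" using assms by simp
      then show "Min (insert 0 U) - 1 < u" by simp
    qed (use \<open>L = {}\<close> in simp)
  next
    assume "U = {}"
    show thesis
    proof (rule that[of "Max (insert 0 L) + 1"])
      fix l assume "l \<in> L"
      then have "l \<le> Max (insert 0 L)" using assms by simp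
      then show "l < Max (insert 0 L) + 1" by simp
    qed (use \<open>U = {}\<close> in simp)
  qed
next
  case False
  then have "Max L < Min U" using assms by simp
  then obtain x where "Max L < x" "x < Min U" using dense by blast
  then show thesis using assms False by (intro that[of x]) auto
qed

lemma positive_complex_params:
  "positive_params (complex_params as) \<longleftrightarrow> (\<forall>(\<alpha>, A) \<in> set as. A > 0)"
  by (auto simp: positive_params_def complex_params_def)

lemma fox_chi_complex_params: "fox_chi m n (complex_params as) (complex_params bs) = fox_chi m n as bs"
  by (simp add: fox_chi_def complex_params_def take_map drop_map case_prod_unfold o_def)

lemma admissible_line_complex_params:
  "admissible_line m n (complex_params as) (complex_params bs) \<gamma> \<longleftrightarrow>
     (\<forall>(\<beta>, B) \<in> set (take m bs). \<beta> + B * \<gamma> > 0) \<and> (\<forall>(\<alpha>, A) \<in> set (take n as). 1 - \<alpha> - A * \<gamma> > 0)"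
  by (auto simp: admissible_line_def complex_params_def take_map case_prod_unfold)

lemma beta_min_le: "(\<beta>, B) \<in> set (take m bs) \<Longrightarrow> beta_min m bs \<le> ereal (\<beta> / B)"
  unfolding beta_min_def by (rule INF_lower2) auto

lemma alpha_min_le: "(\<alpha>, A) \<in> set (take n as) \<Longrightarrow> alpha_min n as \<le> ereal ((1 - \<alpha>) / A)"
  unfolding alpha_min_def by (rule INF_lower2) auto

text \<open>The map \<open>s\<close> to \<open>\<omega> - \<Lambda> * s\<close> exchanges left and
  right, so the second function contributes lower bounds for \<open>\<gamma>\<close> through its
  \<open>\<alpha>\<close> and upper bounds through its \<open>\<beta>\<close>. Each lower bound has
  to lie below each upper one: \<open>gap1\<close> and \<open>gap2\<close> compare bounds of the
  same function, \<open>omega_lower\<close> compares \<open>L1\<close> with \<open>U2\<close>, and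
  \<open>omega_upper\<close> compares \<open>L2\<close> with \<open>U1\<close>.\<close>

lemma exists_common_admissible_line:
  fixes \<Lambda> \<omega> :: real
  assumes pos: "\<forall>(\<alpha>, A) \<in> set a1. A > 0" "\<forall>(\<beta>, B) \<in> set b1. B > 0"
      "\<forall>(\<alpha>, A) \<in> set a2. A > 0" "\<forall>(\<beta>, B) \<in> set b2. B > 0"
    and gap1: "- beta_min m1 b1 < alpha_min n1 a1"
    and gap2: "- beta_min m2 b2 < alpha_min n2 a2"
    and Lambda: "\<Lambda> > 0"
    and omega_lower: "- (ereal \<Lambda> * beta_min m1 b1) - beta_min m2 b2 < ereal \<omega>"
    and omega_upper: "ereal \<omega> < ereal \<Lambda> * alpha_min n1 a1 + alpha_min n2 a2"
  obtains \<gamma> where "admissible_line m1 n1 (complex_params a1) (complex_params b1) \<gamma>"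
    "admissible_line m2 n2 (complex_params a2) (complex_params b2) (\<omega> - \<Lambda> * \<gamma>)"
proof -
  define L1 where "L1 = (\<lambda>(\<beta>, B). - \<beta> / B) ` set (take m1 b1)"
  define U1 where "U1 = (\<lambda>(\<alpha>, A). (1 - \<alpha>) / A) ` set (take n1 a1)"
  define L2 where "L2 = (\<lambda>(\<alpha>, A). (\<omega> - (1 - \<alpha>) / A) / \<Lambda>) ` set (take n2 a2)"
  define U2 where "U2 = (\<lambda>(\<beta>, B). (\<omega> + \<beta> / B) / \<Lambda>) ` set (take m2 b2)"
  have L1: "ereal (- l) \<ge> beta_min m1 b1" if "l \<in> L1" for l
    using that beta_min_le unfolding L1_def by auto
  have U1: "ereal u \<ge> alpha_min n1 a1" if "u \<in> U1" for u
    using that alpha_min_le unfolding U1_def by auto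
  have L2: "ereal (\<omega> - \<Lambda> * l) \<ge> alpha_min n2 a2" if "l \<in> L2" for l
    using that alpha_min_le Lambda unfolding L2_def by auto
  have U2: "ereal (\<Lambda> * u - \<omega>) \<ge> beta_min m2 b2" if "u \<in> U2" for u
    using that beta_min_le Lambda unfolding U2_def by auto
  have "l < u" if lu: "l \<in> L1 \<union> L2" "u \<in> U1 \<union> U2" for l u
  proof -
    consider "l \<in> L1" "u \<in> U1" | "l \<in> L1" "u \<in> U2" | "l \<in> L2" "u \<in> U1" | "l \<in> L2" "u \<in> U2"
      using lu by blast
    then show ?thesis
    proof cases
      case 1
      have "- ereal (- l) \<le> - beta_min m1 b1" using L1[OF 1(1)] by (simp only: ereal_minus_le_minus)
      also note gap1
      also note U1[OF 1(2)]
      finally show ?thesis by simp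
    next
      case 2
      have "ereal \<Lambda> * beta_min m1 b1 \<le> ereal \<Lambda> * ereal (- l)"
        using L1[OF 2(1)] Lambda by (intro ereal_mult_left_mono) auto
      then have "- (ereal \<Lambda> * ereal (- l)) - ereal (\<Lambda> * u - \<omega>) \<le> - (ereal \<Lambda> * beta_min m1 b1) - beta_min m2 b2"
        using U2[OF 2(2)] by (intro ereal_minus_mono) (simp only: ereal_minus_le_minus)
      also note omega_lower
      finally have "\<Lambda> * l < \<Lambda> * u" by simp
      then show ?thesis using Lambda by simp
    next
      case 3
      note omega_upper
      also have "ereal \<Lambda> * alpha_min n1 a1 + alpha_min n2 a2 \<le> ereal \<Lambda> * ereal u + ereal (\<omega> - \<Lambda> * l)"
        using U1[OF 3(2)] L2[OF 3(1)] Lambda by (intro add_mono ereal_mult_left_mono) auto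
      finally have "\<Lambda> * l < \<Lambda> * u" by simp
      then show ?thesis using Lambda by simp
    next
      case 4
      have "- ereal (\<Lambda> * u - \<omega>) \<le> - beta_min m2 b2" using U2[OF 4(2)] by (simp only: ereal_minus_le_minus)
      also note gap2
      also note L2[OF 4(1)]
      finally have "\<Lambda> * l < \<Lambda> * u" by simp
      then show ?thesis using Lambda by simp
    qed
  qed
  moreover have "finite (L1 \<union> L2)" "finite (U1 \<union> U2)"
    by (simp_all add: L1_def L2_def U1_def U2_def)
  ultimately obtain \<gamma> where \<gamma>: "\<And>l. l \<in> L1 \<union> L2 \<Longrightarrow> l < \<gamma>" "\<And>u. u \<in> U1 \<union> U2 \<Longrightarrow> \<gamma> < u"
    using exists_between_finite_sets by metis
  show thesis
  proof (rule that)
    show "admissible_line m1 n1 (complex_params a1) (complex_params b1) \<gamma>"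
      unfolding admissible_line_complex_params
    proof safe
      fix \<beta> B assume *: "(\<beta>, B) \<in> set (take m1 b1)"
      then have "B > 0" using pos by (auto dest: in_set_takeD)
      moreover from * have "- \<beta> / B < \<gamma>" by (intro \<gamma>) (force simp: L1_def)
      ultimately show "0 < \<beta> + B * \<gamma>" by (simp add: field_simps)
    next
      fix \<alpha> A assume *: "(\<alpha>, A) \<in> set (take n1 a1)"
      then have "A > 0" using pos by (auto dest: in_set_takeD)
      moreover from * have "\<gamma> < (1 - \<alpha>) / A" by (intro \<gamma>) (force simp: U1_def)
      ultimately show "0 < 1 - \<alpha> - A * \<gamma>" by (simp add: field_simps)
    qed
    show "admissible_line m2 n2 (complex_params a2) (complex_params b2) (\<omega> - \<Lambda> * \<gamma>)"
      unfolding admissible_line_complex_params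
    proof safe
      fix \<beta> B assume *: "(\<beta>, B) \<in> set (take m2 b2)"
      then have "B > 0" using pos by (auto dest: in_set_takeD)
      moreover from * have "\<gamma> < (\<omega> + \<beta> / B) / \<Lambda>" by (intro \<gamma>) (force simp: U2_def)
      ultimately show "0 < \<beta> + B * (\<omega> - \<Lambda> * \<gamma>)" using Lambda by (simp add: field_simps)
    next
      fix \<alpha> A assume *: "(\<alpha>, A) \<in> set (take n2 a2)"
      then have "A > 0" using pos by (auto dest: in_set_takeD)
      moreover from * have "(\<omega> - (1 - \<alpha>) / A) / \<Lambda> < \<gamma>" by (intro \<gamma>) (force simp: L2_def)
      ultimately show "0 < 1 - \<alpha> - A * (\<omega> - \<Lambda> * \<gamma>)" using Lambda by (simp add: field_simps)
    qed
  qed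
qed

text \<open>\<open>fox_H\<close> is a total function, so that the resulting H-function is defined
  has to be asserted beside its positivity.\<close>

theorem corollary5p4:
  fixes m1 n1 m2 n2 :: nat
    and a1 b1 a2 b2 a3 b3 :: "(real \<times> real) list"
    and \<Lambda> \<omega> :: real
  assumes defined1: "fox_H_params m1 n1 (complex_params a1) (complex_params b1)"
    and defined2: "fox_H_params m2 n2 (complex_params a2) (complex_params b2)"
    and pos1: "\<And>t::real. t > 0 \<Longrightarrow> fox_H m1 n1 (complex_params a1) (complex_params b1) t > 0"
    and pos2: "\<And>t::real. t > 0 \<Longrightarrow> fox_H m2 n2 (complex_params a2) (complex_params b2) t > 0"
    and chi1: "fox_chi m1 n1 a1 b1 > 0"
    and chi2: "fox_chi m2 n2 a2 b2 > 0"
    and gap1: "- beta_min m1 b1 < alpha_min n1 a1"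
    and gap2: "- beta_min m2 b2 < alpha_min n2 a2"
    and Lambda: "\<Lambda> > 0"
    and omega_lower: "- (ereal \<Lambda> * beta_min m1 b1) - beta_min m2 b2 < ereal \<omega>"
    and omega_upper: "ereal \<omega> < ereal \<Lambda> * alpha_min n1 a1 + alpha_min n2 a2"
    and a3: "a3 = take n1 a1 @ map (\<lambda>(\<beta>, B). (1 - \<beta> - \<omega> * B, \<Lambda> * B)) b2 @ drop n1 a1"
    and b3: "b3 = take m1 b1 @ map (\<lambda>(\<alpha>, A). (1 - \<alpha> - \<omega> * A, \<Lambda> * A)) a2 @ drop m1 b1"
  shows "fox_H_params (m1 + n2) (n1 + m2) (complex_params a3) (complex_params b3) \<and>
    (\<forall>t::real. t > 0 \<longrightarrow>
       fox_H (m1 + n2) (n1 + m2) (complex_params a3) (complex_params b3) t > 0)"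
proof -
  let ?\<alpha> = "\<lambda>(\<beta>, B). (1 - \<beta> - \<omega> * B, \<Lambda> * B)"
  have len: "n1 \<le> length a1" "m1 \<le> length b1" "n2 \<le> length a2" "m2 \<le> length b2"
    and params: "positive_params (complex_params a1)" "positive_params (complex_params b1)"
      "positive_params (complex_params a2)" "positive_params (complex_params b2)"
    using defined1 defined2 by (auto simp: fox_H_params_def positive_params_def complex_params_def)
  \<comment> \<open>Upper and lower parameters of the second function change places, but numerator
    factors stay in the numerator: the transformed lists begin with their numerator entries and
    follow those of the first function.\<close>
  have split3: "take (n1 + m2) a3 = take n1 a1 @ map ?\<alpha> (take m2 b2)"
    "drop (n1 + m2) a3 = map ?\<alpha> (drop m2 b2) @ drop n1 a1"
    "take (m1 + n2) b3 = take m1 b1 @ map ?\<alpha> (take n2 a2)"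
    "drop (m1 + n2) b3 = map ?\<alpha> (drop n2 a2) @ drop m1 b1"
    using len by (simp_all add: a3 b3 take_map drop_map)
  have params3: "positive_params (complex_params a3)" "positive_params (complex_params b3)"
    using params Lambda unfolding positive_complex_params a3 b3
    by (auto dest!: in_set_takeD in_set_dropD)
  obtain \<gamma> where line1: "admissible_line m1 n1 (complex_params a1) (complex_params b1) \<gamma>"
    and line2: "admissible_line m2 n2 (complex_params a2) (complex_params b2) (\<omega> - \<Lambda> * \<gamma>)"
    using exists_common_admissible_line[OF params[unfolded positive_complex_params] gap1 gap2 Lambda omega_lower omega_upper]
    by blast
  have line3: "admissible_line (m1 + n2) (n1 + m2) (complex_params a3) (complex_params b3) \<gamma>"
    using line1 line2 unfolding admissible_line_complex_params split3 by (auto simp: algebra_simps)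
  have chi3: "fox_chi (m1 + n2) (n1 + m2) (complex_params a3) (complex_params b3) > 0"
  proof -
    \<comment> \<open>The scales of the second function are multiplied by \<open>\<Lambda>\<close>
      and keep their signs in the sum.\<close>
    have "fox_chi (m1 + n2) (n1 + m2) a3 b3 = fox_chi m1 n1 a1 b1 + \<Lambda> * fox_chi m2 n2 a2 b2"
      unfolding fox_chi_def split3 by (simp add: case_prod_unfold o_def sum_list_const_mult algebra_simps)
    then show ?thesis using chi1 chi2 Lambda by (simp add: fox_chi_complex_params add_pos_pos)
  qed
  let ?\<phi>1 = "\<lambda>y. fox_Xi m1 n1 (complex_params a1) (complex_params b1) (Complex \<gamma> y)"
  let ?\<phi>2 = "\<lambda>y. fox_Xi m2 n2 (complex_params a2) (complex_params b2) (Complex (\<omega> - \<Lambda> * \<gamma>) y)"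
  have Xi3: "fox_Xi (m1 + n2) (n1 + m2) (complex_params a3) (complex_params b3) (Complex \<gamma> y) =
      ?\<phi>1 y * ?\<phi>2 (- (\<Lambda> * y))" for y
  proof -
    \<comment> \<open>For \<open>s = Complex \<gamma> y\<close> the point
      \<open>\<omega> - \<Lambda> * s\<close> has real part
      \<open>\<omega> - \<Lambda> * \<gamma>\<close> and imaginary part
      \<open>- (\<Lambda> * y)\<close>. Both kinds of Gamma arguments of the transformed parameters
      become arguments of the opposite kind at this point.\<close>
    have args: "of_real (1 - c - \<omega> * k) + of_real (\<Lambda> * k) * Complex \<gamma> y =
        1 - of_real c - of_real k * Complex (\<omega> - \<Lambda> * \<gamma>) (- (\<Lambda> * y))"
      "1 - of_real (1 - c - \<omega> * k) - of_real (\<Lambda> * k) * Complex \<gamma> y =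
        of_real c + of_real k * Complex (\<omega> - \<Lambda> * \<gamma>) (- (\<Lambda> * y))" for c k
      by (simp_all add: complex_eq_iff algebra_simps)
    show ?thesis
      unfolding fox_Xi_def complex_params_def take_map drop_map split3 map_append map_map
        prod_list.append o_def case_prod_unfold fst_conv snd_conv args
      by (simp only: times_divide_times_eq mult_ac)
  qed
  note chi = chi1[folded fox_chi_complex_params] chi2[folded fox_chi_complex_params]
  obtain M where M: "\<And>y. norm (?\<phi>2 y) \<le> M"
    using bounded_fox_Xi_line[OF params(3,4) chi(2) line2] by blast
  have "fourier (\<lambda>y. ?\<phi>1 y * ?\<phi>2 (- (\<Lambda> * y))) x > 0" for x
  proof (rule fourier_product_pos)
    show "integrable lborel ?\<phi>1" by (rule integrable_fox_Xi_line[OF params(1,2) chi(1) line1])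
    show "continuous_on UNIV ?\<phi>2" by (rule continuous_on_fox_Xi_line[OF params(3,4) chi(2) line2])
    show "integrable lborel ?\<phi>2" by (rule integrable_fox_Xi_line[OF params(3,4) chi(2) line2])
    show "integrable lborel (fourier ?\<phi>2)" by (rule integrable_fourier_fox_Xi[OF params(3,4) chi(2) line2])
    show "norm (?\<phi>2 y) \<le> M" for y by (rule M)
    show "fourier ?\<phi>1 u > 0" for u
      using pos1[of "exp u"] fox_H_exp_pos_iff[OF params(1,2) chi(1) line1] by simp
    show "fourier ?\<phi>2 u > 0" for u
      using pos2[of "exp u"] fox_H_exp_pos_iff[OF params(3,4) chi(2) line2] by simp
  qed
  then have exp_pos: "fox_H (m1 + n2) (n1 + m2) (complex_params a3) (complex_params b3) (exp x) > 0" for x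
    unfolding fox_H_exp_pos_iff[OF params3 chi3 line3] Xi3 .
  have "fox_H (m1 + n2) (n1 + m2) (complex_params a3) (complex_params b3) t > 0" if "t > 0" for t
    using exp_pos[of "ln t"] that by simp
  moreover have "fox_H_params (m1 + n2) (n1 + m2) (complex_params a3) (complex_params b3)"
    using params3 line3 by (rule fox_H_params_of_admissible_line)
      (use len in \<open>simp_all add: complex_params_def a3 b3\<close>)
  ultimately show ?thesis by blast
qed

end
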